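(* Every thick Toeplitz shift is non-tame.
   Context: **Shifts and tameness.** For a finite alphabet $K$, a shift $(X,\sigma)$ is a closed $\sigma$-invariant subset $X\subseteq K^{\mathbb Z}$ with $\sigma(x)_n=x_{n+1}$. It is *non-tame* if there are disjoint subsets $V_0,V_1\subseteq K$ and a sequence $(t_n)_{n\in\mathbb N}$ of integers such that for every $\varphi\in\{0,1\}^{\mathbb N}$ there is $x\in X$ with $x_{t_n}\in V_{\varphi(n)}$ for all $n$. A *Toeplitz shift* is a shift over a finite alphabet which is an almost one-to-one extension of an odometer $(\mathbb Z_{(\ell_n)},+1)$, where $\mathbb Z_{(\ell_n)}=\prod_n\mathbb Z/\ell_n\mathbb Z$ with addition with carry. **Bratteli-Vershik systems.** A *Bratteli diagram* is a graph $B=(V,E)$, $V=\bigsqcup_{n\ge0}V_n$, $E=\bigsqcup_{n\ge 0}E_n$, all $V_n,E_n$ finite, $V_0=\{v_0\}$, with range and source maps $r,s:E\to V$ satisfying $r(E_n)=V_{n+1}$, $s(E_n)=V_n$. $X_B$ is the space of infinite paths $(\gamma_n)_{n\ge0}$, $\gamma_n\in E_n$, $r(\gamma_n)=s(\gamma_{n+1})$, with the topology inherited from $\prod_n E_n$. $B$ is *simple* if for every $m$ there is $n>m$ such that every $w\in V_m$ and $v\in V_n$ are joined by a path. $B$ is *ordered* if each $r^{-1}(v)$ is totally ordered, i.e. its edges are labelled bijectively by $0,\dots,|r^{-1}(v)|-1$ (labelling $\omega$). The order is *proper* if there is a unique infinite path with all edges maximal and a unique one with all edges minimal. Then the *Vershik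 map* $\varphi_\omega:X_B\to X_B$ sends the maximal path to the minimal path, and any other path $\gamma$ to the path obtained by taking the least $n$ with $\gamma_n$ not maximal, replacing $\gamma_n$ by its successor $\gamma_n'$ in $r^{-1}(r(\gamma_n))$, and $\gamma_0\dots\gamma_{n-1}$ by the path of minimal edges from $v_0$ to $s(\gamma_n')$. $B$ has the *equal path number property* with characteristic sequence $(\ell_n)_{n\ge0}$ if $|r^{-1}(v)|=\ell_n$ for all $v\in V_{n+1}$. The system $(X_B,\varphi_\omega)$ is *expansive* if there is $k$ such that for distinct $x,y\in X_B$ the initial segments of length $k$ of $\varphi_\omega^n(x)$ and $\varphi_\omega^n(y)$ differ for some $n\in\mathbb Z$. A *Toeplitz Bratteli-Vershik system* is an expansive, simple, properly ordered Bratteli-Vershik system with the equal path number property. (By Gjerde-Johansen these are, up to conjugacy, exactly the Toeplitz shifts.) For $0\le i<\ell_n$ let $\theta^{(n)}_i:V_{n+1}\to V_n$ map $v$ to the source of the unique edge with range $v$ and label $i$. **Extended diagram and thickness.** The *extended Bratteli diagram* $\tilde B$ has level-$n$ vertex set $\tilde V_n$ = all nonempty subsets of $V_n$; its edge set $\tilde E_n$ contains an edge labelled $i$ ($0\le i<\ell_n$) with source $A\in\tilde V_n$ and range $C\in\tilde V_{n+1}$ iff $\theta^{(n)}_i(C)=A$. $X_{\tilde B}$ is the set of infinite paths in $\tilde B$ starting at the top vertex. Along such a path the cardinalities of the vertices are non-decreasing. The path has *thickness* $k\in\mathbb N$ if its level-$n$ vertices have cardinality $k$ for all large $n$, and *infinite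 thickness* otherwise; $X^k_{\tilde B}$ ($k\in\mathbb N\cup\{\infty\}$) is the set of paths of thickness $k$. A pair of *parallel edges* is a pair of edges in $\tilde E_n$ with the same source and same range but distinct labels. A *double path* is a pair of paths in $X_{\tilde B}$ whose $n$-th edges are parallel for each $n>0$ (both paths traverse the same vertices at levels $n\geq 1$, and the thickness of the double path is their common thickness). The largest $k\in\mathbb N\cup\{\infty\}$ such that $X^k_{\tilde B}$ is uncountable is the *essential thickness* of $(X_B,\varphi_\omega)$. $(X_B,\varphi_\omega)$ is *thick* if its essential thickness $k$ satisfies $1<k<\infty$ and there is a double path of thickness $k$. A Toeplitz shift is *thick* if it is conjugate to a thick Toeplitz Bratteli-Vershik system. *)

theory Defs
  imports "HOL-Analysis.Analysis" "HOL-Library.Extended_Nat" "HOL-Library.Disjoint_Sets"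
begin

definition full_shift_topology :: "'a set \<Rightarrow> (int \<Rightarrow> 'a) topology" where
  "full_shift_topology K = product_topology (\<lambda>_. discrete_topology K) UNIV"

definition shift_map :: "(int \<Rightarrow> 'a) \<Rightarrow> (int \<Rightarrow> 'a)" where
  "shift_map x = (\<lambda>n. x (n + 1))"

definition is_shift :: "'a set \<Rightarrow> (int \<Rightarrow> 'a) set \<Rightarrow> bool" where
  "is_shift K X \<longleftrightarrow>
     finite K \<and> closedin (full_shift_topology K) X \<and> shift_map ` X = X"

definition shift_topology :: "'a set \<Rightarrow> (int \<Rightarrow> 'a) set \<Rightarrow> (int \<Rightarrow> 'a) topology" where
  "shift_topology K X = subtopology (full_shift_topology K) X"

definition non_tame :: "'a set \<Rightarrow> (int \<Rightarrow> 'a) set \<Rightarrow> bool" where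
  "non_tame K X \<longleftrightarrow>
     (\<exists>V0 V1. V0 \<subseteq> K \<and> V1 \<subseteq> K \<and> V0 \<inter> V1 = {} \<and>
       (\<exists>t :: nat \<Rightarrow> int. \<forall>\<phi> :: nat \<Rightarrow> bool.
          \<exists>x\<in>X. \<forall>n. x (t n) \<in> (if \<phi> n then V1 else V0)))"

definition odometer_topology :: "(nat \<Rightarrow> nat) \<Rightarrow> (nat \<Rightarrow> nat) topology" where
  "odometer_topology l = product_topology (\<lambda>n. discrete_topology {..<l n}) UNIV"

text \<open>Addition of \<open>1 = (1, 0, 0, \<dots>)\<close> with carry: the carry reaches position \<open>n\<close>
  iff all earlier digits are the largest possible.\<close>

definition odometer_succ :: "(nat \<Rightarrow> nat) \<Rightarrow> (nat \<Rightarrow> nat) \<Rightarrow> (nat \<Rightarrow> nat)" where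
  "odometer_succ l z =
     (\<lambda>n. if \<forall>m<n. z m = l m - 1 then (z n + 1) mod l n else z n)"

definition factor_map ::
  "'x topology \<Rightarrow> ('x \<Rightarrow> 'x) \<Rightarrow> 'y topology \<Rightarrow> ('y \<Rightarrow> 'y) \<Rightarrow> ('x \<Rightarrow> 'y) \<Rightarrow> bool" where
  "factor_map TX f TY g \<pi> \<longleftrightarrow>
     continuous_map TX TY \<pi> \<and> \<pi> ` topspace TX = topspace TY \<and>
     (\<forall>x\<in>topspace TX. \<pi> (f x) = g (\<pi> x))"

text \<open>Conventions vary; here the points alone in their fibre are required to be dense, which for a
  minimal system agrees with asking for a residual set or for one singleton fibre.\<close>

definition almost_one_to_one_extension ::
  "'x topology \<Rightarrow> ('x \<Rightarrow> 'x) \<Rightarrow> 'y topology \<Rightarrow> ('y \<Rightarrow> 'y) \<Rightarrow> bool" where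
  "almost_one_to_one_extension TX f TY g \<longleftrightarrow>
     (\<exists>\<pi>. factor_map TX f TY g \<pi> \<and>
        TX closure_of {x \<in> topspace TX. \<forall>y\<in>topspace TX. \<pi> y = \<pi> x \<longrightarrow> y = x}
          = topspace TX)"

definition toeplitz_shift :: "'a set \<Rightarrow> (int \<Rightarrow> 'a) set \<Rightarrow> bool" where
  "toeplitz_shift K X \<longleftrightarrow>
     is_shift K X \<and>
     (\<exists>l. (\<forall>n. 1 \<le> l n) \<and>
        almost_one_to_one_extension (shift_topology K X) shift_map
          (odometer_topology l) (odometer_succ l))"

definition conjugate ::
  "'x topology \<Rightarrow> ('x \<Rightarrow> 'x) \<Rightarrow> 'y topology \<Rightarrow> ('y \<Rightarrow> 'y) \<Rightarrow> bool" where
  "conjugate TX f TY g \<longleftrightarrow>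
     (\<exists>h. homeomorphic_map TX TY h \<and> (\<forall>x\<in>topspace TX. h (f x) = g (h x)))"

text \<open>Level \<open>n\<close> edges go from level \<open>n\<close> to level \<open>n + 1\<close>. The values of \<open>src\<close>, \<open>rng\<close> and
  \<open>label\<close> outside the edge set are irrelevant.\<close>

record ('v, 'e) bratteli =
  verts :: "nat \<Rightarrow> 'v set"
  edges :: "nat \<Rightarrow> 'e set"
  src :: "'e \<Rightarrow> 'v"
  rng :: "'e \<Rightarrow> 'v"
  label :: "'e \<Rightarrow> nat"

definition bratteli_diagram :: "('v, 'e) bratteli \<Rightarrow> bool" where
  "bratteli_diagram B \<longleftrightarrow>
     disjoint_family (verts B) \<and> disjoint_family (edges B) \<and>
     (\<forall>n. finite (verts B n) \<and> finite (edges B n)) \<and>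
     (\<exists>v0. verts B 0 = {v0}) \<and>
     (\<forall>n. rng B ` edges B n = verts B (Suc n) \<and> src B ` edges B n = verts B n)"

definition paths :: "('v, 'e) bratteli \<Rightarrow> (nat \<Rightarrow> 'e) set" where
  "paths B = {\<gamma>. \<forall>n. \<gamma> n \<in> edges B n \<and> rng B (\<gamma> n) = src B (\<gamma> (Suc n))}"

definition path_topology :: "('v, 'e) bratteli \<Rightarrow> (nat \<Rightarrow> 'e) topology" where
  "path_topology B =
     subtopology (product_topology (\<lambda>n. discrete_topology (edges B n)) UNIV) (paths B)"

definition joined :: "('v, 'e) bratteli \<Rightarrow> nat \<Rightarrow> 'v \<Rightarrow> nat \<Rightarrow> 'v \<Rightarrow> bool" where
  "joined B m w n v \<longleftrightarrow>
     (\<exists>\<gamma>. (\<forall>i\<in>{m..<n}. \<gamma> i \<in> edges B i) \<and>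
          (\<forall>i. m \<le> i \<and> Suc i < n \<longrightarrow> rng B (\<gamma> i) = src B (\<gamma> (Suc i))) \<and>
          src B (\<gamma> m) = w \<and> rng B (\<gamma> (n - 1)) = v)"

definition simple_diagram :: "('v, 'e) bratteli \<Rightarrow> bool" where
  "simple_diagram B \<longleftrightarrow>
     (\<forall>m. \<exists>n>m. \<forall>w\<in>verts B m. \<forall>v\<in>verts B n. joined B m w n v)"

definition in_edges :: "('v, 'e) bratteli \<Rightarrow> 'v \<Rightarrow> 'e set" where
  "in_edges B v = {e \<in> (\<Union>n. edges B n). rng B e = v}"

definition ordered_diagram :: "('v, 'e) bratteli \<Rightarrow> bool" where
  "ordered_diagram B \<longleftrightarrow>
     (\<forall>n. \<forall>v\<in>verts B (Suc n).
        bij_betw (label B) (in_edges B v) {..<card (in_edges B v)})"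

definition minimal_edge :: "('v, 'e) bratteli \<Rightarrow> 'e \<Rightarrow> bool" where
  "minimal_edge B e \<longleftrightarrow> label B e = 0"

definition maximal_edge :: "('v, 'e) bratteli \<Rightarrow> 'e \<Rightarrow> bool" where
  "maximal_edge B e \<longleftrightarrow> Suc (label B e) = card (in_edges B (rng B e))"

definition proper_order :: "('v, 'e) bratteli \<Rightarrow> bool" where
  "proper_order B \<longleftrightarrow>
     (\<exists>!\<gamma>. \<gamma> \<in> paths B \<and> (\<forall>n. maximal_edge B (\<gamma> n))) \<and>
     (\<exists>!\<gamma>. \<gamma> \<in> paths B \<and> (\<forall>n. minimal_edge B (\<gamma> n)))"

definition vershik :: "('v, 'e) bratteli \<Rightarrow> (nat \<Rightarrow> 'e) \<Rightarrow> (nat \<Rightarrow> 'e)" where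
  "vershik B \<gamma> =
     (if \<forall>n. maximal_edge B (\<gamma> n)
      then THE \<delta>. \<delta> \<in> paths B \<and> (\<forall>n. minimal_edge B (\<delta> n))
      else let n = (LEAST n. \<not> maximal_edge B (\<gamma> n)) in
        THE \<delta>. \<delta> \<in> paths B \<and>
          (\<forall>m<n. minimal_edge B (\<delta> m)) \<and>
          rng B (\<delta> n) = rng B (\<gamma> n) \<and> label B (\<delta> n) = Suc (label B (\<gamma> n)) \<and>
          (\<forall>m>n. \<delta> m = \<gamma> m))"

definition vershik_power :: "('v, 'e) bratteli \<Rightarrow> int \<Rightarrow> (nat \<Rightarrow> 'e) \<Rightarrow> (nat \<Rightarrow> 'e)" where
  "vershik_power B n =
     (if 0 \<le> n then vershik B ^^ nat n
      else inv_into (paths B) (vershik B) ^^ nat (- n))"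

definition expansive :: "('v, 'e) bratteli \<Rightarrow> bool" where
  "expansive B \<longleftrightarrow>
     (\<exists>k. \<forall>x\<in>paths B. \<forall>y\<in>paths B. x \<noteq> y \<longrightarrow>
        (\<exists>n. \<exists>i<k. vershik_power B n x i \<noteq> vershik_power B n y i))"

definition has_characteristic_sequence :: "('v, 'e) bratteli \<Rightarrow> (nat \<Rightarrow> nat) \<Rightarrow> bool" where
  "has_characteristic_sequence B l \<longleftrightarrow>
     (\<forall>n. \<forall>v\<in>verts B (Suc n). card (in_edges B v) = l n)"

definition toeplitz_BV :: "('v, 'e) bratteli \<Rightarrow> bool" where
  "toeplitz_BV B \<longleftrightarrow>
     bratteli_diagram B \<and> ordered_diagram B \<and> simple_diagram B \<and> proper_order B \<and>
     (\<exists>l. has_characteristic_sequence B l) \<and> expansive B"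

definition characteristic_sequence :: "('v, 'e) bratteli \<Rightarrow> nat \<Rightarrow> nat" where
  "characteristic_sequence B = (THE l. has_characteristic_sequence B l)"

text \<open>No level index is needed on \<open>theta\<close>: the vertex \<open>v\<close> determines its level.\<close>

definition theta :: "('v, 'e) bratteli \<Rightarrow> nat \<Rightarrow> 'v \<Rightarrow> 'v" where
  "theta B i v = src B (THE e. e \<in> in_edges B v \<and> label B e = i)"

text \<open>An edge of the extended diagram is a triple (source, label, range). Not every vertex
  of the extended diagram needs to be the source of an edge, so it need not satisfy
  \<open>bratteli_diagram\<close>.\<close>

definition extended_diagram ::
  "('v, 'e) bratteli \<Rightarrow> ('v set, 'v set \<times> nat \<times> 'v set) bratteli" where
  "extended_diagram B =
     \<lparr> verts = (\<lambda>n. {A. A \<noteq> {} \<and> A \<subseteq> verts B n}),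
       edges = (\<lambda>n. {(A, i, C). A \<noteq> {} \<and> A \<subseteq> verts B n \<and> C \<noteq> {} \<and> C \<subseteq> verts B (Suc n) \<and>
                      i < characteristic_sequence B n \<and> theta B i ` C = A}),
       src = (\<lambda>(A, i, C). A),
       rng = (\<lambda>(A, i, C). C),
       label = (\<lambda>(A, i, C). i) \<rparr>"

definition paths_of_thickness ::
  "('v, 'e) bratteli \<Rightarrow> enat \<Rightarrow> (nat \<Rightarrow> 'v set \<times> nat \<times> 'v set) set" where
  "paths_of_thickness B k =
     (let has = (\<lambda>\<gamma> j. \<forall>\<^sub>F n in sequentially. card (src (extended_diagram B) (\<gamma> n)) = j)
      in case k of
           enat j \<Rightarrow> {\<gamma> \<in> paths (extended_diagram B). has \<gamma> j}
         | \<infinity> \<Rightarrow> {\<gamma> \<in> paths (extended_diagram B). \<nexists>j. has \<gamma> j})"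

definition parallel_edges ::
  "('v, 'e) bratteli \<Rightarrow> nat \<Rightarrow> 'v set \<times> nat \<times> 'v set \<Rightarrow> 'v set \<times> nat \<times> 'v set \<Rightarrow> bool" where
  "parallel_edges B n e e' \<longleftrightarrow>
     (let D = extended_diagram B in
        e \<in> edges D n \<and> e' \<in> edges D n \<and>
        src D e = src D e' \<and> rng D e = rng D e' \<and> label D e \<noteq> label D e')"

text \<open>The edges at level 0 may coincide.\<close>

definition double_path ::
  "('v, 'e) bratteli \<Rightarrow> (nat \<Rightarrow> 'v set \<times> nat \<times> 'v set) \<Rightarrow>
     (nat \<Rightarrow> 'v set \<times> nat \<times> 'v set) \<Rightarrow> bool" where
  "double_path B \<gamma> \<gamma>' \<longleftrightarrow>
     \<gamma> \<in> paths (extended_diagram B) \<and> \<gamma>' \<in> paths (extended_diagram B) \<and>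
     (\<forall>n>0. parallel_edges B n (\<gamma> n) (\<gamma>' n))"

definition is_essential_thickness :: "('v, 'e) bratteli \<Rightarrow> enat \<Rightarrow> bool" where
  "is_essential_thickness B k \<longleftrightarrow>
     uncountable (paths_of_thickness B k) \<and>
     (\<forall>j. uncountable (paths_of_thickness B j) \<longrightarrow> j \<le> k)"

definition thick_BV :: "('v, 'e) bratteli \<Rightarrow> bool" where
  "thick_BV B \<longleftrightarrow>
     (\<exists>k. is_essential_thickness B k \<and> 1 < k \<and> k < \<infinity> \<and>
        (\<exists>\<gamma> \<gamma>'. double_path B \<gamma> \<gamma>' \<and>
           \<gamma> \<in> paths_of_thickness B k \<and> \<gamma>' \<in> paths_of_thickness B k))"

end

theory Submission imports Defs "HOL-Combinatorics.Cycles" begin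

text \<open>Record a path by its label sequence, read as a number in mixed radix, and by its vertices, so
  that the Vershik map adds one to the number. Let \<open>k\<close> be the essential thickness and \<open>A n\<close> the vertices
  of the double path. Its labels yield uncountably many label sequences, and only countably many
  extended paths are thicker than \<open>k\<close>; so some sequence \<open>z\<close> has \<open>A n\<close> as its eventual range, that is,
  long words of \<open>z\<close> map every vertex into \<open>A n\<close>. Since an order with a unique minimal path forces
  coincidences, the words mapping \<open>A b\<close> bijectively to \<open>A a\<close> are not an arithmetic progression: there
  are bijective words \<open>I\<close>, \<open>J\<close> and a number \<open>c\<close> such that \<open>I - c\<close> is bijective, but \<open>J - c\<close> is not, and
  both map into \<open>A a\<close>. As the permutations realised by bijective words form a group, \<open>I\<close> and \<open>J\<close> can be
  prolonged so as to act equally. Stacking such blocks, the choice between \<open>I\<close> and \<open>J\<close> is free in every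
  block and can be read off after translation by the respective \<open>c\<close>.\<close>

section \<open>Eventual ranges in inverse systems of finite sets\<close>

lemma decreasing_finite_stable:
  fixes C :: "nat \<Rightarrow> 'a set"
  assumes dec: "\<And>i j. n \<le> i \<Longrightarrow> i \<le> j \<Longrightarrow> C j \<subseteq> C i" and fin: "finite (C n)"
  shows "\<exists>k\<ge>n. \<forall>m\<ge>k. C m = C k"
proof -
  obtain k where k: "k \<ge> n" "\<And>m. m \<ge> n \<Longrightarrow> card (C k) \<le> card (C m)"
    using ex_has_least_nat[of "\<lambda>m. m \<ge> n" n "\<lambda>m. card (C m)"] by blast
  have "C m = C k" if "m \<ge> k" for m
  proof (rule card_seteq)
    show "finite (C k)" using fin dec[of n k] k(1) finite_subset by blast
    show "C m \<subseteq> C k" using dec k(1) that by blast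
    show "card (C k) \<le> card (C m)" using k that by auto
  qed
  then show ?thesis using k(1) by blast
qed

text \<open>The bonding map \<open>f n o ... o f (m - 1)\<close> from level \<open>m\<close> down to
  level \<open>n\<close>, extended by the identity when \<open>m \<le> n\<close>.\<close>

primrec compose_maps :: "(nat \<Rightarrow> 'a \<Rightarrow> 'a) \<Rightarrow> nat \<Rightarrow> nat \<Rightarrow> 'a \<Rightarrow> 'a" where
  "compose_maps f n 0 v = v"
| "compose_maps f n (Suc m) v = (if n \<le> m then compose_maps f n m (f m v) else v)"

lemma compose_maps_same [simp]: "compose_maps f n n v = v"
  by (cases n) auto

lemma compose_maps_split:
  "n \<le> k \<Longrightarrow> k \<le> m \<Longrightarrow> compose_maps f n m v = compose_maps f n k (compose_maps f k m v)"
proof (induction m arbitrary: v)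
  case (Suc m)
  then show ?case by (cases "k = Suc m") auto
qed auto

locale finite_inverse_system =
  fixes V :: "nat \<Rightarrow> 'a set" and f :: "nat \<Rightarrow> 'a \<Rightarrow> 'a"
  assumes finite_V: "finite (V n)" and nonempty_V: "V n \<noteq> {}"
    and maps_V: "f n ` V (Suc n) \<subseteq> V n"
begin

text \<open>By finiteness, these are the points of level \<open>n\<close> that lie on a thread of
  the inverse system.\<close>

definition eventual_range :: "nat \<Rightarrow> 'a set" where
  "eventual_range n = (\<Inter>m\<in>{n..}. compose_maps f n m ` V m)"

lemma compose_maps_decreasing:
  assumes "n \<le> k" "k \<le> m"
  shows "compose_maps f n m ` V m \<subseteq> compose_maps f n k ` V k"
  using assms(2)
proof (induction m rule: dec_induct)
  case (step m)
  have "compose_maps f n (Suc m) ` V (Suc m) = compose_maps f n m ` f m ` V (Suc m)"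
    using step assms by (auto simp: image_image)
  then show ?case using maps_V[of m] step.IH by blast
qed auto

lemma eventual_range_attained:
  "\<exists>k\<ge>n. \<forall>m\<ge>k. compose_maps f n m ` V m = eventual_range n"
proof -
  define C where "C m = compose_maps f n m ` V m" for m
  have dec: "C m \<subseteq> C k" if "n \<le> k" "k \<le> m" for k m
    unfolding C_def using that by (rule compose_maps_decreasing)
  moreover have "finite (C n)" using finite_V by (simp add: C_def)
  ultimately obtain k where k: "k \<ge> n" "\<And>m. m \<ge> k \<Longrightarrow> C m = C k"
    using decreasing_finite_stable[of n C] by blast
  have "C k \<subseteq> C m" if "m \<ge> n" for m
    using k(2)[of m] dec[OF that, of k] by (cases "m \<ge> k") auto
  then have "eventual_range n = C k" using k(1) by (auto simp: eventual_range_def C_def)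
  then show ?thesis using k unfolding C_def by metis
qed

lemma eventual_range_subset: "eventual_range n \<subseteq> V n"
  by (auto simp: eventual_range_def)

lemma eventual_range_nonempty: "eventual_range n \<noteq> {}"
  using eventual_range_attained[of n] nonempty_V by (metis image_is_empty order_refl)

text \<open>Both eventual ranges are images of one sufficiently high level, and its map to level
  \<open>n\<close> factors through level \<open>n + 1\<close>.\<close>

lemma image_eventual_range: "f n ` eventual_range (Suc n) = eventual_range n"
proof -
  obtain k where k: "k \<ge> n" "\<And>m. m \<ge> k \<Longrightarrow> compose_maps f n m ` V m = eventual_range n"
    using eventual_range_attained by blast
  obtain k' where k': "k' \<ge> Suc n"
    "\<And>m. m \<ge> k' \<Longrightarrow> compose_maps f (Suc n) m ` V m = eventual_range (Suc n)"
    using eventual_range_attained by blast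
  let ?m = "max k k'"
  have "compose_maps f n ?m v = f n (compose_maps f (Suc n) ?m v)" for v
    using k'(1) by (subst compose_maps_split[of n "Suc n"]) auto
  then have "compose_maps f n ?m ` V ?m = f n ` compose_maps f (Suc n) ?m ` V ?m"
    by (simp add: image_image)
  then show ?thesis using k(2)[of ?m] k'(2)[of ?m] by simp
qed

text \<open>Maximality: such a family is at each level the image of its own higher members. This
  places the vertices of the double path inside eventual ranges.\<close>

lemma subset_eventual_range:
  assumes "\<And>m. m \<ge> n \<Longrightarrow> A m \<subseteq> V m" "\<And>m. m \<ge> n \<Longrightarrow> f m ` A (Suc m) = A m"
  shows "A n \<subseteq> eventual_range n"
proof -
  have "compose_maps f n m ` A m = A n" if "m \<ge> n" for m
    using that
  proof (induction m rule: dec_induct)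
    case (step m)
    have "compose_maps f n (Suc m) ` A (Suc m) = compose_maps f n m ` f m ` A (Suc m)"
      using step by (auto simp: image_image)
    then show ?case using assms(2) step by simp
  qed auto
  then show ?thesis using assms(1) unfolding eventual_range_def by fastforce
qed

end

section \<open>Addresses of paths\<close>

locale toeplitz_diagram =
  fixes B :: "('v, 'e) bratteli"
  assumes toeplitz: "toeplitz_BV B"
begin

abbreviation V :: "nat \<Rightarrow> 'v set" where "V \<equiv> verts B"
abbreviation l :: "nat \<Rightarrow> nat" where "l \<equiv> characteristic_sequence B"

lemma
  shows disjoint_V: "disjoint_family V" and finite_V: "finite (V n)"
    and card_V0: "\<exists>v0. V 0 = {v0}"
    and rng_E: "rng B ` edges B n = V (Suc n)" and src_E: "src B ` edges B n = V n"
    and ordered: "ordered_diagram B" and proper: "proper_order B"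
  using toeplitz by (auto simp: toeplitz_BV_def bratteli_diagram_def)

lemma V_nonempty: "V n \<noteq> {}"
proof (induction n)
  case (Suc n)
  then have "edges B n \<noteq> {}" using src_E[of n] by blast
  then show ?case using rng_E[of n] by blast
qed (use card_V0 in auto)

lemma rng_in: "e \<in> edges B n \<Longrightarrow> rng B e \<in> V (Suc n)"
  using rng_E by blast

lemma src_in: "e \<in> edges B n \<Longrightarrow> src B e \<in> V n"
  using src_E by blast

text \<open>\<open>in_edges\<close> collects edges of all levels; disjointness of the vertex levels
  pins down the level of the edge.\<close>

lemma in_edges_eq:
  assumes "v \<in> V (Suc n)"
  shows "in_edges B v = {e \<in> edges B n. rng B e = v}"
proof -
  have "m = n" if "e \<in> edges B m" "rng B e = v" for e m
  proof (rule ccontr)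
    assume "m \<noteq> n"
    then have "V (Suc m) \<inter> V (Suc n) = {}"
      using disjoint_family_onD[OF disjoint_V, of "Suc m" "Suc n"] by simp
    then show False using rng_in[OF that(1)] that(2) assms by blast
  qed
  then show ?thesis by (auto simp: in_edges_def)
qed

text \<open>The definite description \<open>characteristic_sequence\<close> is justified because
  every level has a vertex, whose in-degree determines the entry.\<close>

lemma card_in_edges:
  assumes "v \<in> V (Suc n)"
  shows "card (in_edges B v) = l n"
proof -
  obtain l0 where l0: "has_characteristic_sequence B l0"
    using toeplitz by (auto simp: toeplitz_BV_def)
  have "l1 = l0" if "has_characteristic_sequence B l1" for l1
  proof
    fix n
    obtain w where "w \<in> V (Suc n)" using V_nonempty by blast
    then show "l1 n = l0 n" using that l0 by (metis has_characteristic_sequence_def)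
  qed
  then have "l = l0" unfolding characteristic_sequence_def using l0 by (blast intro: the_equality)
  then show ?thesis using l0 assms by (auto simp: has_characteristic_sequence_def)
qed

lemma bij_label:
  assumes "v \<in> V (Suc n)"
  shows "bij_betw (label B) {e \<in> edges B n. rng B e = v} {..<l n}"
  using ordered assms card_in_edges[OF assms] in_edges_eq[OF assms]
  unfolding ordered_diagram_def by metis

lemma label_less: "e \<in> edges B n \<Longrightarrow> label B e < l n"
  using bij_label[OF rng_in] by (fastforce dest: bij_betw_apply)

lemma edge_eqI:
  assumes "e \<in> edges B n" "e' \<in> edges B n" "rng B e = rng B e'" "label B e = label B e'"
  shows "e = e'"
  using bij_label[OF rng_in[OF assms(2)]] assms by (auto simp: bij_betw_def dest: inj_onD)

lemma edge_ex:
  assumes "v \<in> V (Suc n)" "i < l n"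
  shows "\<exists>e\<in>edges B n. rng B e = v \<and> label B e = i"
proof -
  have "i \<in> label B ` {e \<in> edges B n. rng B e = v}"
    using bij_label[OF assms(1)] assms(2) by (simp add: bij_betw_def)
  then show ?thesis by auto
qed

lemma theta_eq:
  assumes "e \<in> edges B n"
  shows "theta B (label B e) (rng B e) = src B e"
proof -
  have "(THE e'. e' \<in> in_edges B (rng B e) \<and> label B e' = label B e) = e"
    using in_edges_eq[OF rng_in[OF assms]] edge_eqI assms by (intro the_equality) auto
  then show ?thesis by (simp add: theta_def)
qed

lemma theta_in:
  assumes "v \<in> V (Suc n)" "i < l n"
  shows "theta B i v \<in> V n"
  using edge_ex[OF assms] theta_eq src_in by metis

lemma l_pos: "0 < l n"
  using V_nonempty[of n] src_E[of n] label_less by fastforce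

text \<open>The number of paths from level \<open>a\<close> into one vertex of level
  \<open>b\<close>. Thus \<open>height 0 b\<close> is the common height of the Kakutani-Rokhlin
  towers of level \<open>b\<close>, and the heights serve as place values.\<close>

definition height :: "nat \<Rightarrow> nat \<Rightarrow> nat" where
  "height a b = (\<Prod>i\<in>{a..<b}. l i)"

lemma height_same [simp]: "height a a = 1"
  by (simp add: height_def)

lemma height_Suc: "a \<le> b \<Longrightarrow> height a (Suc b) = height a b * l b"
  by (simp add: height_def)

lemma height_pos: "0 < height a b"
  using l_pos by (auto simp: height_def intro: prod_pos)

lemma height_split: "a \<le> b \<Longrightarrow> b \<le> c \<Longrightarrow> height a c = height a b * height b c"
  unfolding height_def by (metis prod.atLeastLessThan_concat)

text \<open>The number \<open>M\<close> encodes in mixed radix the labels \<open>i\<^sub>a, \<dots>, i\<^sub>b\<^sub>-\<^sub>1\<close> with \<open>i\<^sub>a\<close> the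
  least significant one, so that Vershik moves become additions.\<close>

primrec descend :: "nat \<Rightarrow> nat \<Rightarrow> nat \<Rightarrow> 'v \<Rightarrow> 'v" where
  "descend a 0 M v = v"
| "descend a (Suc b) M v =
    (if a \<le> b then descend a b (M mod height a b) (theta B (M div height a b) v) else v)"

lemma descend_same [simp]: "descend a a M v = v"
  by (cases a) auto

lemma mixed_radix_less:
  assumes "M < height a b" "M' < height b c" "a \<le> b" "b \<le> c"
  shows "M + height a b * M' < height a c"
proof -
  have "M + height a b * M' < height a b * Suc M'" using assms by simp
  also have "\<dots> \<le> height a b * height b c" using assms by (intro mult_le_mono2) auto
  finally show ?thesis by (simp add: height_split[OF assms(3,4)])
qed

lemma mixed_radix_ex:
  assumes "M < height a c" "a \<le> b" "b \<le> c"
  obtains M1 M2 where "M = M1 + height a b * M2" "M1 < height a b" "M2 < height b c"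
proof
  show "M = M mod height a b + height a b * (M div height a b)" by simp
  show "M mod height a b < height a b" using height_pos by simp
  show "M div height a b < height b c"
    using assms(1) unfolding height_split[OF assms(2,3)]
    by (simp add: less_mult_imp_div_less mult.commute)
qed

text \<open>Division by \<open>height a b\<close> separates the low word from the high one, so
  concatenation of words becomes addition. The low word acts last, as it belongs to the lower
  levels.\<close>

lemma descend_split:
  assumes "a \<le> b" "b \<le> c" "M < height a b" "M' < height b c"
  shows "descend a c (M + height a b * M') v = descend a b M (descend b c M' v)"
  using assms(2,4)
proof (induction c arbitrary: M' v rule: dec_induct)
  case (step c)
  have h: "height a c = height a b * height b c" using step assms by (intro height_split) auto
  have "(M + height a b * M') mod height a c
      = height a b * ((M + height a b * M') div height a b mod height b c)
        + (M + height a b * M') mod height a b"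
    unfolding h by (rule mod_mult2_eq)
  then have 1: "(M + height a b * M') mod height a c = M + height a b * (M' mod height b c)"
    using assms height_pos[of a b] by simp
  have 2: "(M + height a b * M') div height a c = M' div height b c"
    using assms height_pos[of a b] by (simp add: h div_mult2_eq)
  show ?case using step assms height_pos[of b c] by (simp add: 1 2)
qed auto

lemma descend_in:
  assumes "a \<le> b" "M < height a b" "v \<in> V b"
  shows "descend a b M v \<in> V a"
  using assms
proof (induction b arbitrary: M v rule: dec_induct)
  case (step b)
  have "M div height a b < l b"
    using step by (simp add: height_Suc less_mult_imp_div_less mult.commute)
  then show ?case using step height_pos[of a b] theta_in by auto
qed auto

text \<open>Inverse to the digit extraction in \<open>descend\<close>: the digit \<open>z i\<close>
  gets place value \<open>height a i\<close>.\<close>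

primrec number :: "(nat \<Rightarrow> nat) \<Rightarrow> nat \<Rightarrow> nat \<Rightarrow> nat" where
  "number z a 0 = 0"
| "number z a (Suc b) = (if a \<le> b then number z a b + height a b * z b else 0)"

lemma number_same [simp]: "number z a a = 0"
  by (cases a) auto

lemma number_less:
  assumes "a \<le> b" "\<And>i. a \<le> i \<Longrightarrow> i < b \<Longrightarrow> z i < l i"
  shows "number z a b < height a b"
  using assms
proof (induction b rule: dec_induct)
  case (step b)
  then show ?case using mixed_radix_less[of "number z a b" a b "z b" "Suc b"]
    by (auto simp: height_Suc)
qed auto

lemma descend_number:
  assumes "\<And>i. a \<le> i \<Longrightarrow> z i < l i"
  shows "descend a b (number z a b) v = compose_maps (\<lambda>i. theta B (z i)) a b v"
proof (induction b arbitrary: v)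
  case (Suc b)
  then show ?case using number_less[of a b z] assms height_pos[of a b] by auto
qed auto

section \<open>Paths as floors of towers, and the Vershik map as addition of one\<close>

definition tail_paths :: "nat \<Rightarrow> (nat \<Rightarrow> 'e) set" where
  "tail_paths m = {\<gamma>. \<forall>n\<ge>m. \<gamma> n \<in> edges B n \<and> rng B (\<gamma> n) = src B (\<gamma> (Suc n))}"

lemma tail_paths_0: "tail_paths 0 = paths B"
  by (auto simp: tail_paths_def paths_def)

lemma paths_tail: "\<gamma> \<in> paths B \<Longrightarrow> \<gamma> \<in> tail_paths m"
  by (auto simp: tail_paths_def paths_def)

text \<open>The floor occupied by the path in the level \<open>m\<close> tower over the vertex
  \<open>src B (\<gamma> m)\<close>.\<close>

definition address :: "(nat \<Rightarrow> 'e) \<Rightarrow> nat \<Rightarrow> nat" where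
  "address \<gamma> m = number (\<lambda>i. label B (\<gamma> i)) 0 m"

lemma address_0 [simp]: "address \<gamma> 0 = 0"
  and address_Suc [simp]: "address \<gamma> (Suc m) = address \<gamma> m + height 0 m * label B (\<gamma> m)"
  by (simp_all add: address_def)

lemma label_zero: "address \<gamma> m = 0 \<Longrightarrow> i < m \<Longrightarrow> label B (\<gamma> i) = 0"
  by (induction m) (auto simp: less_Suc_eq height_pos[THEN less_imp_neq, THEN not_sym])

lemma address_less: "\<gamma> \<in> paths B \<Longrightarrow> address \<gamma> m < height 0 m"
  unfolding address_def by (rule number_less) (auto simp: paths_def label_less)

text \<open>The edges are recovered downwards: the leading digit of the address and the vertex above
  it fix the top edge, whose source is the next vertex.\<close>

lemma address_unique:
  assumes "\<gamma> \<in> paths B" "\<delta> \<in> paths B" "address \<gamma> m = address \<delta> m" "src B (\<gamma> m) = src B (\<delta> m)" "i < m"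
  shows "\<gamma> i = \<delta> i"
  using assms(3-5)
proof (induction m)
  case (Suc m)
  have lt: "address \<gamma> m < height 0 m" "address \<delta> m < height 0 m" using assms address_less by auto
  have "label B (\<gamma> m) = address \<gamma> (Suc m) div height 0 m"
    "label B (\<delta> m) = address \<delta> (Suc m) div height 0 m" using lt by auto
  then have lab: "label B (\<gamma> m) = label B (\<delta> m)" using Suc by metis
  then have eq: "\<gamma> m = \<delta> m" using assms(1,2) Suc edge_eqI[of "\<gamma> m" m "\<delta> m"]
    by (auto simp: paths_def)
  have "address \<gamma> m = address \<delta> m" using Suc lab by simp
  then show ?case using Suc eq by (auto simp: less_Suc_eq)
qed auto

text \<open>Every floor is occupied: edges labelled by the digits of \<open>N\<close> are prepended
  downwards. A tail path is unconstrained below its first level, so updating one edge lowers that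
  level by one.\<close>

lemma tail_extend:
  assumes "\<gamma> \<in> tail_paths m" "N < height 0 m"
  shows "\<exists>\<delta>\<in>paths B. (\<forall>i\<ge>m. \<delta> i = \<gamma> i) \<and> address \<delta> m = N"
  using assms
proof (induction m arbitrary: \<gamma> N)
  case 0
  then show ?case by (auto simp: tail_paths_0)
next
  case (Suc m)
  have sm: "src B (\<gamma> (Suc m)) \<in> V (Suc m)" using Suc.prems src_in by (auto simp: tail_paths_def)
  obtain N1 N2 where N: "N = N1 + height 0 m * N2" "N1 < height 0 m" "N2 < height m (Suc m)"
    using mixed_radix_ex[of N 0 "Suc m" m] Suc.prems by auto
  then obtain e where e: "e \<in> edges B m" "rng B e = src B (\<gamma> (Suc m))" "label B e = N2"
    using edge_ex[OF sm] by (auto simp: height_Suc)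
  have "\<gamma>(m := e) \<in> tail_paths m" using Suc.prems e by (auto simp: tail_paths_def)
  from Suc.IH[OF this N(2)] obtain \<delta> where
    "\<delta> \<in> paths B" "\<forall>i\<ge>m. \<delta> i = (\<gamma>(m := e)) i" "address \<delta> m = N1" by blast
  then show ?case using e N by (intro bexI[of _ \<delta>]) auto
qed

text \<open>Dependent choice going upwards: each vertex of \<open>A m\<close> has an outgoing edge
  with label in \<open>D m\<close> that ends in \<open>A (Suc m)\<close>. With all labels this
  continues an arbitrary vertex, with the label 0 alone it yields minimal paths.\<close>

lemma tail_from_vertices:
  assumes "u \<in> A n" "\<And>m. m \<ge> n \<Longrightarrow> A m \<subseteq> V m"
    "\<And>m. m \<ge> n \<Longrightarrow> A m \<subseteq> (\<Union>i\<in>D m. theta B i ` A (Suc m))"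
    "\<And>m. m \<ge> n \<Longrightarrow> D m \<subseteq> {..<l m}"
  shows "\<exists>\<gamma>\<in>tail_paths n. src B (\<gamma> n) = u \<and> (\<forall>m\<ge>n. label B (\<gamma> m) \<in> D m)"
proof -
  have step: "\<exists>e. e \<in> edges B m \<and> src B e = w \<and> label B e \<in> D m \<and> rng B e \<in> A (Suc m)"
    if m: "m \<ge> n" and w: "w \<in> A m" for m w
  proof -
    obtain i w' where i: "i \<in> D m" "w' \<in> A (Suc m)" "w = theta B i w'" using assms(3)[OF m] w by blast
    then obtain e where "e \<in> edges B m" "rng B e = w'" "label B e = i"
      using edge_ex[of w' m i] assms(2)[of "Suc m"] assms(4)[OF m] m by auto
    then show ?thesis using i theta_eq by metis
  qed
  define P where "P k e \<longleftrightarrow> e \<in> edges B (n + k) \<and> label B e \<in> D (n + k) \<and> rng B e \<in> A (Suc (n + k))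
    \<and> (k = 0 \<longrightarrow> src B e = u)" for k e
  have "\<exists>e. P 0 e" using step[of n u] assms(1) by (auto simp: P_def)
  moreover have "\<exists>e'. P (Suc k) e' \<and> rng B e = src B e'" if "P k e" for k e
    using step[of "n + Suc k" "rng B e"] that by (auto simp: P_def)
  ultimately obtain f where f: "\<And>k. P k (f k) \<and> rng B (f k) = src B (f (Suc k))"
    using dependent_nat_choice[of P "\<lambda>_ e e'. rng B e = src B e'"] by metis
  have "(\<lambda>m. f (m - n)) \<in> tail_paths n"
    using f by (auto simp: tail_paths_def P_def Suc_diff_le) (metis le_add_diff_inverse)
  moreover have "src B (f (n - n)) = u" using f[of 0] by (simp add: P_def)
  moreover have "label B (f (m - n)) \<in> D m" if "m \<ge> n" for m
    using f[of "m - n"] that by (simp add: P_def)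
  ultimately show ?thesis by (intro bexI[of _ "\<lambda>m. f (m - n)"]) auto
qed

lemma tail_from_vertex:
  assumes "v \<in> V m"
  shows "\<exists>\<gamma>\<in>tail_paths m. src B (\<gamma> m) = v"
proof -
  have "V n \<subseteq> (\<Union>i\<in>{..<l n}. theta B i ` V (Suc n))" for n
  proof
    fix w assume "w \<in> V n"
    then have "w \<in> src B ` edges B n" by (simp add: src_E)
    then obtain e where e: "e \<in> edges B n" "w = src B e" by (rule imageE)
    have "w \<in> theta B (label B e) ` V (Suc n)"
      using theta_eq[OF e(1)] e(2) rng_in[OF e(1)] by (intro image_eqI[of _ _ "rng B e"]) auto
    then show "w \<in> (\<Union>i\<in>{..<l n}. theta B i ` V (Suc n))"
      using label_less[OF e(1)] by blast
  qed
  then show ?thesis using tail_from_vertices[of v V m "\<lambda>n. {..<l n}"] assms by auto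
qed

text \<open>The low digits of an address form the address at the lower level; the high digits are
  the labels in between, which carry the upper vertex down.\<close>

lemma path_descend:
  assumes "\<gamma> \<in> paths B" "n \<le> m" "address \<gamma> m = N1 + height 0 n * N2" "N1 < height 0 n"
  shows "address \<gamma> n = N1" "src B (\<gamma> n) = descend n m N2 (src B (\<gamma> m))"
proof -
  have "address \<gamma> n = N1 \<and> src B (\<gamma> n) = descend n m N2 (src B (\<gamma> m))"
    using assms(2,3)
  proof (induction m arbitrary: N2 rule: dec_induct)
    case base
    then have "address \<gamma> n div height 0 n = N2" using assms(4) by simp
    then have "N2 = 0" using address_less[OF assms(1)] by auto
    then show ?case using base by simp
  next
    case (step m)
    have h: "height 0 m = height 0 n * height n m" using step by (intro height_split) auto
    have a: "address \<gamma> (Suc m) = address \<gamma> m + height 0 m * label B (\<gamma> m)" by simp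
    have "address \<gamma> m = address \<gamma> (Suc m) mod height 0 m"
      using address_less[OF assms(1), of m] by simp
    also have "\<dots> = N1 + height 0 n * (N2 mod height n m)"
      unfolding step.prems h using assms(4) by (subst mod_mult2_eq) auto
    finally have IH: "address \<gamma> n = N1 \<and> src B (\<gamma> n) = descend n m (N2 mod height n m) (src B (\<gamma> m))"
      by (rule step.IH)
    have "label B (\<gamma> m) = address \<gamma> (Suc m) div height 0 m"
      using address_less[OF assms(1), of m] by simp
    also have "\<dots> = N2 div height n m"
      unfolding step.prems h using assms(4) by (simp add: div_mult2_eq)
    finally have "src B (\<gamma> m) = theta B (N2 div height n m) (src B (\<gamma> (Suc m)))"
      using theta_eq[of "\<gamma> m" m] assms(1) by (auto simp: paths_def)
    then show ?case using IH step by simp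
  qed
  then show "address \<gamma> n = N1" "src B (\<gamma> n) = descend n m N2 (src B (\<gamma> m))" by auto
qed

text \<open>Below the top floor of a tower the carry ends before level \<open>m\<close>, so the path
  climbs one floor and stays in its tower.\<close>

lemma vershik_step:
  assumes \<gamma>: "\<gamma> \<in> paths B" and less: "Suc (address \<gamma> m) < height 0 m"
  shows "vershik B \<gamma> \<in> paths B" "\<And>i. i \<ge> m \<Longrightarrow> vershik B \<gamma> i = \<gamma> i"
    "address (vershik B \<gamma>) m = Suc (address \<gamma> m)"
proof -
  have E: "\<gamma> n \<in> edges B n" and R: "rng B (\<gamma> n) = src B (\<gamma> (Suc n))" for n
    using \<gamma> by (auto simp: paths_def)
  have mx: "maximal_edge B (\<gamma> n) \<longleftrightarrow> Suc (label B (\<gamma> n)) = l n" for n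
    using card_in_edges[OF rng_in[OF E]] by (simp add: maximal_edge_def)
  \<comment> \<open>If all edges below level \<open>k\<close> are maximal, all digits are as large
    as possible and the path is on the top floor.\<close>
  have full: "Suc (address \<gamma> k) = height 0 k" if "\<forall>n<k. maximal_edge B (\<gamma> n)" for k
    using that
  proof (induction k)
    case (Suc k)
    then have "Suc (address \<gamma> (Suc k)) = height 0 k * Suc (label B (\<gamma> k))" by simp
    also have "\<dots> = height 0 (Suc k)" using Suc.prems mx[of k] by (simp add: height_Suc)
    finally show ?case .
  qed auto
  define n where "n = (LEAST n. \<not> maximal_edge B (\<gamma> n))"
  obtain n' where n': "n' < m" "\<not> maximal_edge B (\<gamma> n')" using full[of m] less by auto
  have n: "\<not> maximal_edge B (\<gamma> n)" unfolding n_def by (rule LeastI[of _ n']) (use n' in auto)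
  have "n \<le> n'" unfolding n_def by (rule Least_le) (use n' in auto)
  then have nm: "n < m" using n' by simp
  have below: "\<forall>k<n. maximal_edge B (\<gamma> k)" unfolding n_def using not_less_Least by blast
  have "Suc (label B (\<gamma> n)) < l n" using n label_less[OF E, of n] mx[of n] by linarith
  then obtain e where e: "e \<in> edges B n" "rng B e = rng B (\<gamma> n)" "label B e = Suc (label B (\<gamma> n))"
    using edge_ex[OF rng_in[OF E]] by metis
  have "\<gamma>(n := e) \<in> tail_paths n" using E R e by (auto simp: tail_paths_def)
  from tail_extend[OF this height_pos] obtain \<delta> where
    \<delta>: "\<delta> \<in> paths B" "\<forall>i\<ge>n. \<delta> i = (\<gamma>(n := e)) i" "address \<delta> n = 0" by auto
  have zero: "label B (\<delta> i) = 0" if "i < n" for i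
    by (rule label_zero[OF \<delta>(3) that])
  \<comment> \<open>The description is unambiguous: the edge at \<open>n\<close> is fixed by range
    and label, and the minimal edges below it by \<open>address_unique\<close>.\<close>
  have "(THE \<delta>. \<delta> \<in> paths B \<and> (\<forall>m<n. minimal_edge B (\<delta> m)) \<and>
          rng B (\<delta> n) = rng B (\<gamma> n) \<and> label B (\<delta> n) = Suc (label B (\<gamma> n)) \<and>
          (\<forall>m>n. \<delta> m = \<gamma> m)) = \<delta>"
  proof (rule the_equality)
    show "\<delta> \<in> paths B \<and> (\<forall>m<n. minimal_edge B (\<delta> m)) \<and>
          rng B (\<delta> n) = rng B (\<gamma> n) \<and> label B (\<delta> n) = Suc (label B (\<gamma> n)) \<and>
          (\<forall>m>n. \<delta> m = \<gamma> m)"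
      using \<delta> e zero by (auto simp: minimal_edge_def)
    fix \<epsilon> assume \<epsilon>: "\<epsilon> \<in> paths B \<and> (\<forall>m<n. minimal_edge B (\<epsilon> m)) \<and>
          rng B (\<epsilon> n) = rng B (\<gamma> n) \<and> label B (\<epsilon> n) = Suc (label B (\<gamma> n)) \<and>
          (\<forall>m>n. \<epsilon> m = \<gamma> m)"
    have "\<epsilon> n = e" using e \<epsilon> by (intro edge_eqI) (auto simp: paths_def)
    then have ge: "\<epsilon> i = \<delta> i" if "i \<ge> n" for i using that \<epsilon> \<delta>(2) by (cases "i = n") auto
    have "address \<epsilon> k = 0" if "k \<le> n" for k
      using that \<epsilon> by (induction k) (auto simp: minimal_edge_def)
    then have "\<epsilon> i = \<delta> i" if "i < n" for i
      using address_unique[of \<epsilon> \<delta> n i] \<epsilon> \<delta> ge[of n] that by auto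
    then show "\<epsilon> = \<delta>" using ge by (metis ext not_le)
  qed
  then have eq: "vershik B \<gamma> = \<delta>" using n unfolding vershik_def Let_def n_def[symmetric] by auto
  \<comment> \<open>The carry: the largest digits below \<open>n\<close> turn into zeros while the
    digit at \<open>n\<close> grows by one.\<close>
  have start: "address \<delta> (Suc n) = Suc (address \<gamma> (Suc n))" using \<delta> e full[OF below] by simp
  have "address \<delta> m = Suc (address \<gamma> m)" if "m \<ge> Suc n" for m
    using that
  proof (induction m rule: nat_induct_at_least)
    case (Suc m)
    then show ?case using \<delta>(2) by simp
  qed (rule start)
  then show "address (vershik B \<gamma>) m = Suc (address \<gamma> m)" using eq nm by simp
  show "vershik B \<gamma> \<in> paths B" using eq \<delta> by simp
  show "vershik B \<gamma> i = \<gamma> i" if "i \<ge> m" for i using eq \<delta> nm that by simp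
qed

text \<open>If the ranges along the smallest edges did not shrink to a point, two
  distinct minimal paths would exist.\<close>
lemma minimal_coincidence:
  "\<exists>m\<ge>n. \<exists>u. \<forall>k\<ge>m. descend n k 0 ` V k = {u}"
proof -
  interpret min: finite_inverse_system V "\<lambda>_. theta B 0"
    using finite_V V_nonempty theta_in l_pos by unfold_locales auto
  have "\<exists>u. min.eventual_range n = {u}"
  proof (rule ccontr)
    assume "\<nexists>u. min.eventual_range n = {u}"
    then obtain u u' where u: "u \<in> min.eventual_range n" "u' \<in> min.eventual_range n" "u \<noteq> u'"
      using min.eventual_range_nonempty[of n] by blast
    have "\<exists>\<gamma>\<in>paths B. (\<forall>i. minimal_edge B (\<gamma> i)) \<and> src B (\<gamma> n) = w"
      if w: "w \<in> min.eventual_range n" for w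
    proof -
      obtain \<gamma> where \<gamma>: "\<gamma> \<in> tail_paths n" "src B (\<gamma> n) = w" "\<forall>m\<ge>n. label B (\<gamma> m) = 0"
        using tail_from_vertices[of w min.eventual_range n "\<lambda>_. {0}"] w
          min.eventual_range_subset min.image_eventual_range l_pos by auto
      obtain \<delta> where \<delta>: "\<delta> \<in> paths B" "\<forall>i\<ge>n. \<delta> i = \<gamma> i" "address \<delta> n = 0"
        using tail_extend[OF \<gamma>(1) height_pos] by blast
      then have "label B (\<delta> i) = 0" for i
        using \<gamma>(3) label_zero[OF \<delta>(3)] by (metis not_le)
      then show ?thesis using \<delta> \<gamma> by (intro bexI[of _ \<delta>]) (auto simp: minimal_edge_def)
    qed
    then show False using u proper unfolding proper_order_def by metis
  qed
  then obtain u where u: "min.eventual_range n = {u}" by blast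
  obtain m where m: "m \<ge> n" "\<forall>k\<ge>m. compose_maps (\<lambda>_. theta B 0) n k ` V k = min.eventual_range n"
    using min.eventual_range_attained by blast
  have "number (\<lambda>_. 0) n k = 0" for k by (induction k) auto
  then have "descend n k 0 v = compose_maps (\<lambda>_. theta B 0) n k v" for k v
    using descend_number[of n "\<lambda>_. 0" k v] l_pos by auto
  then have "\<forall>k\<ge>m. descend n k 0 ` V k = {u}" using m u by simp
  then show ?thesis using m(1) by blast
qed

end

section \<open>Words along a double path\<close>

lemma uncountable_bool_sequences: "uncountable (UNIV :: (nat \<Rightarrow> bool) set)"
proof
  assume "countable (UNIV :: (nat \<Rightarrow> bool) set)"
  then obtain f :: "nat \<Rightarrow> nat \<Rightarrow> bool" where "range f = UNIV"
    by (metis UNIV_not_empty range_from_nat_into)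
  then obtain n where "f n = (\<lambda>i. \<not> f i i)" by (metis UNIV_I imageE)
  then show False by (metis (full_types))
qed

context toeplitz_diagram
begin

lemma number_split:
  assumes "a \<le> b" "b \<le> c"
  shows "number z a c = number z a b + height a b * number z b c"
  using assms(2)
proof (induction c rule: dec_induct)
  case (step c)
  have "height a c = height a b * height b c" using step assms by (intro height_split) auto
  then show ?case using step assms by (simp add: algebra_simps)
qed auto

lemma image_descend_split:
  assumes "a \<le> b" "b \<le> c" "M < height a b" "M' < height b c"
  shows "descend a c (M + height a b * M') ` S = descend a b M ` descend b c M' ` S"
  unfolding image_image by (rule image_cong) (simp_all add: descend_split[OF assms])

end

text \<open>What is kept of the double path: its vertices \<open>A\<close> and, at each level, two
  different labels that both map \<open>A (Suc n)\<close> onto \<open>A n\<close>. By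
  \<open>z_collapse\<close>, \<open>A\<close> is the whole eventual range of
  \<open>z\<close>.\<close>

locale thick_spine = toeplitz_diagram B for B :: "('v, 'e) bratteli" +
  fixes A :: "nat \<Rightarrow> 'v set" and z y :: "nat \<Rightarrow> nat" and n0 k :: nat
  assumes A_subset: "n \<ge> n0 \<Longrightarrow> A n \<subseteq> V n"
    and card_A: "n \<ge> n0 \<Longrightarrow> card (A n) = k"
    and k_ge: "2 \<le> k"
    and z_less: "n \<ge> n0 \<Longrightarrow> z n < l n"
    and y_less: "n \<ge> n0 \<Longrightarrow> y n < l n"
    and z_neq_y: "n \<ge> n0 \<Longrightarrow> z n \<noteq> y n"
    and z_image: "n \<ge> n0 \<Longrightarrow> theta B (z n) ` A (Suc n) = A n"
    and y_image: "n \<ge> n0 \<Longrightarrow> theta B (y n) ` A (Suc n) = A n"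
    and z_collapse: "n \<ge> n0 \<Longrightarrow> \<exists>m\<ge>n. descend n m (number z n m) ` V m = A n"
begin

lemma finite_A: "n \<ge> n0 \<Longrightarrow> finite (A n)"
  using A_subset finite_V finite_subset by blast

text \<open>As all \<open>A n\<close> have \<open>k\<close> elements from level \<open>n0\<close>
  on, such a word acts bijectively between them.\<close>

definition good :: "nat \<Rightarrow> nat \<Rightarrow> nat \<Rightarrow> bool" where
  "good a b M \<longleftrightarrow> M < height a b \<and> descend a b M ` A b = A a"

lemma good_same: "good a a 0"
  by (simp add: good_def)

lemma good_step:
  assumes "n \<ge> n0"
  shows "good n (Suc n) (z n)" "good n (Suc n) (y n)"
  using z_less[OF assms] y_less[OF assms] z_image[OF assms] y_image[OF assms]
  by (auto simp: good_def height_Suc)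

lemma good_concat:
  assumes "a \<le> b" "b \<le> c" "good a b M" "good b c M'"
  shows "good a c (M + height a b * M')"
proof -
  have "descend a c (M + height a b * M') ` A c = A a"
    using image_descend_split[OF assms(1,2)] assms(3,4) by (simp add: good_def)
  then show ?thesis using assms mixed_radix_less by (simp add: good_def)
qed

lemma good_number:
  assumes "n0 \<le> a" "a \<le> b"
  shows "good a b (number z a b)"
  using assms(2)
proof (induction b rule: dec_induct)
  case (step b)
  then show ?case using good_concat[of a b "Suc b" "number z a b" "z b"] good_step[of b] assms
    by simp
qed (simp add: good_same)

lemma good_bij:
  assumes "n0 \<le> a" "a \<le> b" "good a b M"
  shows "bij_betw (descend a b M) (A b) (A a)"
  using assms finite_A[of b] card_A[of a] card_A[of b]
  by (auto simp: good_def bij_betw_def intro!: eq_card_imp_inj_on)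

text \<open>Below a long run of minimal edges all vertices coincide. Hence the set \<open>D\<close> of words that
  descend bijectively contains no element below \<open>l m\<close>, whereas it contains two elements at distance
  \<open>d < l m\<close>. So \<open>d\<close> can be subtracted within \<open>D\<close> from some element, but not from the smallest one.\<close>
lemma block_ex:
  assumes a: "n0 \<le> a"
  shows "\<exists>b>a. \<exists>I J c. c \<le> I \<and> c \<le> J \<and> good a b I \<and> good a b J \<and> good a b (I - c) \<and>
    descend a b (J - c) ` A b \<subset> A a"
proof -
  \<comment> \<open>The prefix \<open>M\<close> sends all of \<open>V m\<close> into
    \<open>A a\<close>. Hence every word placed above it lands in \<open>A a\<close>, even one that
    is not bijective.\<close>
  obtain m where m: "m \<ge> a" "descend a m (number z a m) ` V m = A a"
    using z_collapse[OF a] by blast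
  define M where "M = number z a m"
  have M: "good a m M" using good_number a m by (simp add: M_def)
  obtain b u where b: "b \<ge> Suc m" "descend (Suc m) b 0 ` V b = {u}"
    using minimal_coincidence[of "Suc m"] by blast
  define D where "D = {\<delta>. \<delta> < height m b \<and> good a b (M + height a m * \<delta>)}"
  have less: "M + height a m * \<delta> < height a b" if "\<delta> < height m b" for \<delta>
    using mixed_radix_less[of M a m \<delta> b] M m b that by (auto simp: good_def)
  have split: "descend a b (M + height a m * \<delta>) v = descend a m M (descend m b \<delta> v)"
    if "\<delta> < height m b" for \<delta> v
    using descend_split[of a m b M \<delta>] M m b that by (auto simp: good_def)
  have into: "descend a b (M + height a m * \<delta>) ` A b \<subseteq> A a" if "\<delta> < height m b" for \<delta>
  proof -
    have "descend m b \<delta> ` A b \<subseteq> V m" using descend_in[of m b \<delta>] A_subset[of b] that b m a by auto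
    then show ?thesis using split[OF that] m(2) M_def by auto
  qed
  have in_D: "\<delta> \<in> D" if "good m b \<delta>" for \<delta>
    using that good_concat[OF m(1) _ M that] b by (auto simp: D_def good_def)
  have notin_D: "\<delta> \<notin> D" if "\<delta> < l m" for \<delta>
  proof
    assume "\<delta> \<in> D"
    then have \<delta>: "\<delta> < height m b" "descend a b (M + height a m * \<delta>) ` A b = A a"
      by (auto simp: D_def good_def)
    \<comment> \<open>A number below \<open>l m\<close> has only zero digits above level
      \<open>m\<close>, so all of \<open>A b\<close> passes through \<open>u\<close>.\<close>
    have "descend m b \<delta> v = theta B \<delta> u" if "v \<in> A b" for v
    proof -
      have "descend m b (\<delta> + height m (Suc m) * 0) v
          = descend m (Suc m) \<delta> (descend (Suc m) b 0 v)"
        using b \<open>\<delta> < l m\<close> by (intro descend_split) (auto simp: height_Suc height_pos)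
      moreover have "v \<in> V b" using A_subset[of b] that a m b by auto
      then have "descend (Suc m) b 0 v = u" using b(2) by blast
      ultimately show ?thesis by simp
    qed
    then have "A a \<subseteq> {descend a m M (theta B \<delta> u)}" using \<delta> split by auto
    then have "card (A a) \<le> 1" using card_mono[of "{descend a m M (theta B \<delta> u)}"] by fastforce
    then show False using card_A[OF a] k_ge by simp
  qed
  define Z where "Z = number z (Suc m) b"
  have Z: "good (Suc m) b Z" using good_number a m b by (simp add: Z_def)
  have "z m + l m * Z \<in> D" "y m + l m * Z \<in> D"
    using good_concat[OF _ b(1) _ Z, of m] good_step[of m] a m by (auto intro!: in_D simp: height_Suc)
  \<comment> \<open>The two words differ only in the digit at level \<open>m\<close>, so their
    distance \<open>d\<close> is positive and less than \<open>l m\<close>.\<close>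
  moreover define \<delta> where "\<delta> = min (z m) (y m) + l m * Z"
  moreover define d where "d = max (z m) (y m) - min (z m) (y m)"
  ultimately have \<delta>: "\<delta> \<in> D" "\<delta> + d \<in> D" and d: "0 < d" "d < l m"
    using z_neq_y[of m] z_less[of m] y_less[of m] a m
    by (auto simp: min_def max_def add.commute split: if_splits)
  define e where "e = (LEAST e. e \<in> D)"
  have e: "e \<in> D" unfolding e_def using \<delta>(1) by (rule LeastI)
  then have "l m \<le> e" using notin_D not_le by blast
  then have de: "d \<le> e" "e - d < e" using d by auto
  have ed: "e - d \<notin> D" using not_less_Least[of "e - d" "\<lambda>e. e \<in> D"] de by (simp add: e_def)
  have lt: "e - d < height m b" using e de by (auto simp: D_def)
  let ?f = "\<lambda>\<delta>. M + height a m * \<delta>"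
  have "height a m * d \<le> height a m * e" using de by simp
  then have J: "?f e - height a m * d = ?f (e - d)" by (simp add: diff_mult_distrib2)
  have I: "?f (\<delta> + d) - height a m * d = ?f \<delta>" by (simp add: algebra_simps)
  have "descend a b (?f (e - d)) ` A b \<noteq> A a" using ed lt less[OF lt] by (auto simp: D_def good_def)
  then have "descend a b (?f (e - d)) ` A b \<subset> A a" using into[OF lt] by blast
  moreover have "good a b (?f (\<delta> + d))" "good a b (?f \<delta>)" "good a b (?f e)"
    using \<delta> e by (auto simp: D_def)
  moreover have "height a m * d \<le> ?f (\<delta> + d)" "height a m * d \<le> ?f e"
    using \<open>height a m * d \<le> height a m * e\<close> by (simp_all add: distrib_left trans_le_add2)
  moreover have "a < b" using b m by simp
  ultimately show ?thesis using I J by metis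
qed

section \<open>The group of permutations realised by bijective words\<close>

definition transport :: "nat \<Rightarrow> 'v \<Rightarrow> 'v" where
  "transport n = descend n0 n (number z n0 n)"

lemma transport_bij: "n0 \<le> n \<Longrightarrow> bij_betw (transport n) (A n) (A n0)"
  unfolding transport_def by (rule good_bij) (auto intro: good_number)

lemma transport_number:
  assumes "n0 \<le> a" "a \<le> b"
  shows "transport b v = transport a (descend a b (number z a b) v)"
proof -
  have "number z n0 a < height n0 a" "number z a b < height a b"
    using good_number assms by (auto simp: good_def)
  then show ?thesis unfolding transport_def number_split[OF assms] using assms
    by (intro descend_split) auto
qed

text \<open>Transport along \<open>z\<close> identifies each \<open>A n\<close> with
  \<open>A n0\<close>, so words between different levels become permutations of one set and words of
  \<open>z\<close> become the identity. The value \<open>x\<close> outside \<open>A n0\<close> suits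
  \<open>permutes\<close> and lets composition be an equation between functions.\<close>

definition perm :: "nat \<Rightarrow> nat \<Rightarrow> nat \<Rightarrow> 'v \<Rightarrow> 'v" where
  "perm a b M x = (if x \<in> A n0
     then transport a (descend a b M (inv_into (A b) (transport b) x)) else x)"

lemma perm_transport:
  assumes "n0 \<le> b" "v \<in> A b"
  shows "perm a b M (transport b v) = transport a (descend a b M v)"
  using transport_bij[OF assms(1)] assms(2)
  by (auto simp: perm_def bij_betw_def inv_into_f_f)

lemma perm_eqI:
  assumes "n0 \<le> b" "\<And>v. v \<in> A b \<Longrightarrow> transport a (descend a b M v) = g (transport b v)"
    and "\<And>x. x \<notin> A n0 \<Longrightarrow> g x = x"
  shows "perm a b M = g"
proof
  fix x
  show "perm a b M x = g x"
  proof (cases "x \<in> A n0")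
    case True
    then obtain v where "v \<in> A b" "x = transport b v"
      using transport_bij[OF assms(1)] by (auto simp: bij_betw_def)
    then show ?thesis using assms(1,2) perm_transport by simp
  qed (simp add: perm_def assms(3))
qed

lemma perm_permutes:
  assumes "n0 \<le> a" "a \<le> b" "good a b M"
  shows "perm a b M permutes A n0"
proof (rule bij_imp_permutes)
  have "bij_betw (transport a \<circ> (descend a b M \<circ> inv_into (A b) (transport b))) (A n0) (A n0)"
    using assms transport_bij
    by (intro bij_betw_trans[OF bij_betw_trans[OF bij_betw_inv_into good_bij]]) auto
  then show "bij_betw (perm a b M) (A n0) (A n0)"
    by (rule bij_betw_cong[THEN iffD1, rotated]) (simp add: perm_def)
qed (simp add: perm_def)

lemma perm_number: "n0 \<le> a \<Longrightarrow> a \<le> b \<Longrightarrow> perm a b (number z a b) = id"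
  by (rule perm_eqI) (auto simp flip: transport_number)

lemma perm_concat:
  assumes "n0 \<le> a" "a \<le> b" "b \<le> c" "good a b M" "good b c M'"
  shows "perm a c (M + height a b * M') = perm a b M \<circ> perm b c M'"
proof (rule perm_eqI)
  fix v assume v: "v \<in> A c"
  have "descend b c M' v \<in> A b" using v assms by (auto simp: good_def)
  then show "transport a (descend a c (M + height a b * M') v)
      = (perm a b M \<circ> perm b c M') (transport c v)"
    using v assms by (simp add: perm_transport descend_split good_def)
qed (use assms in \<open>auto simp: perm_def\<close>)

definition perms_from :: "nat \<Rightarrow> ('v \<Rightarrow> 'v) set" where
  "perms_from a = {perm a b M |b M. a \<le> b \<and> good a b M}"

text \<open>Prefixing a word with the \<open>z\<close>-word from \<open>a\<close> to
  \<open>b\<close> leaves its permutation unchanged.\<close>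

lemma perms_from_antimono:
  assumes "n0 \<le> a" "a \<le> b"
  shows "perms_from b \<subseteq> perms_from a"
proof
  fix g assume "g \<in> perms_from b"
  then obtain c M where g: "g = perm b c M" "b \<le> c" "good b c M" by (auto simp: perms_from_def)
  have "perm a c (number z a b + height a b * M) = g"
    using perm_concat[OF assms g(2) good_number[OF assms] g(3)] perm_number[OF assms] g(1) by simp
  moreover have "good a c (number z a b + height a b * M)"
    using good_concat good_number assms g by blast
  moreover have "a \<le> c" using assms g by simp
  ultimately show "g \<in> perms_from a" unfolding perms_from_def by blast
qed

text \<open>From a certain level on, the permutations realised by words starting at a given level form
  one and the same finite semigroup, and hence a group.\<close>
lemma inverse_word_ex:
  "\<exists>n1\<ge>n0. \<forall>a\<ge>n1. \<forall>b\<ge>a. \<forall>M. good a b M \<longrightarrow> (\<exists>c0\<ge>b. \<forall>c\<ge>c0. \<exists>M'. good b c M' \<and>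
     (\<forall>v\<in>A c. descend a c (M + height a b * M') v = descend a c (number z a c) v))"
proof -
  have "perms_from n0 \<subseteq> {g. g permutes A n0}" using perm_permutes by (auto simp: perms_from_def)
  then have "finite (perms_from n0)" using finite_permutations[OF finite_A] finite_subset by blast
  then obtain n1 where n1: "n1 \<ge> n0" "\<And>m. m \<ge> n1 \<Longrightarrow> perms_from m = perms_from n1"
    using decreasing_finite_stable[of n0 perms_from] perms_from_antimono by blast
  define H where "H = perms_from n1"
  have comp: "g \<circ> h \<in> H" if gh: "g \<in> H" "h \<in> H" for g h
  proof -
    obtain b M where g: "g = perm n1 b M" "n1 \<le> b" "good n1 b M"
      using gh(1) by (auto simp: H_def perms_from_def)
    \<comment> \<open>\<open>h\<close> is also realised by a word starting where that of
      \<open>g\<close> ends, since all levels from \<open>n1\<close> on realise the same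
      permutations.\<close>
    have "h \<in> perms_from b" using n1(2)[OF g(2)] gh(2) by (simp add: H_def)
    then obtain c M' where h: "h = perm b c M'" "b \<le> c" "good b c M'"
      by (auto simp: perms_from_def)
    have "g \<circ> h = perm n1 c (M + height n1 b * M')" using perm_concat n1(1) g h by simp
    moreover have "good n1 c (M + height n1 b * M')" using good_concat g h by blast
    moreover have "n1 \<le> c" using g h by simp
    ultimately show ?thesis unfolding H_def perms_from_def by blast
  qed
  have id: "id \<in> H"
    using perm_number[OF n1(1) order_refl] good_same by (force simp: H_def perms_from_def)
  have pow: "g ^^ j \<in> H" if "g \<in> H" for g j
  proof (induction j)
    case (Suc j)
    show ?case unfolding funpow.simps by (rule comp[OF that Suc])
  qed (use id in \<open>simp add: id_def\<close>)
  \<comment> \<open>A permutation of a finite set has finite order, so its inverse is one of its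
    powers.\<close>
  have inv: "\<exists>h\<in>H. g \<circ> h = id" if "g \<in> H" for g
  proof -
    have "g permutes A n0" using that perm_permutes n1(1) by (auto simp: H_def perms_from_def)
    then have "permutation g" using finite_A permutation_permutes by blast
    then obtain q where q: "g ^^ q = id" "q > 0" using permutation_is_nilpotent by blast
    then have "g \<circ> g ^^ (q - 1) = id" by (cases q) auto
    then show ?thesis using pow that by blast
  qed
  have "\<exists>c0\<ge>b. \<forall>c\<ge>c0. \<exists>M'. good b c M' \<and>
     (\<forall>v\<in>A c. descend a c (M + height a b * M') v = descend a c (number z a c) v)"
    if ab: "n1 \<le> a" "a \<le> b" and M: "good a b M" for a b M
  proof -
    have "perm a b M \<in> perms_from a" unfolding perms_from_def using ab M by blast
    then have "perm a b M \<in> H" by (simp add: H_def n1(2)[OF ab(1)])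
    then obtain h where h: "h \<in> H" "perm a b M \<circ> h = id" using inv by blast
    then have "h \<in> perms_from b" using n1(2)[of b] ab by (simp add: H_def)
    then obtain c0 M0 where c0: "h = perm b c0 M0" "b \<le> c0" "good b c0 M0"
      by (auto simp: perms_from_def)
    have n0: "n0 \<le> a" "n0 \<le> b" "n0 \<le> c0" using n1 ab c0 by auto
    have "\<exists>M'. good b c M' \<and>
       (\<forall>v\<in>A c. descend a c (M + height a b * M') v = descend a c (number z a c) v)"
      if c: "c0 \<le> c" for c
    proof (intro exI conjI ballI)
      \<comment> \<open>Padding by \<open>z\<close> reaches every level above \<open>c0\<close>
        without changing the permutation.\<close>
      let ?M' = "M0 + height b c0 * number z c0 c"
      show M': "good b c ?M'" using good_concat[OF c0(2) c c0(3) good_number[OF n0(3) c]] .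
      have "perm b c ?M' = h"
        using perm_concat[OF n0(2) c0(2) c c0(3) good_number[OF n0(3) c]] perm_number[OF n0(3) c] c0(1)
        by simp
      then have p: "perm a c (M + height a b * ?M') = id"
        using perm_concat[OF n0(1) ab(2) _ M M'] h(2) c c0(2) by simp
      fix v assume v: "v \<in> A c"
      have "transport a (descend a c (M + height a b * ?M') v) = transport c v"
        using perm_transport[of c v a "M + height a b * ?M'"] p v c n0 by simp
      also have "\<dots> = transport a (descend a c (number z a c) v)"
        using transport_number[of a c v] n0 ab c c0 by linarith
      finally show "descend a c (M + height a b * ?M') v = descend a c (number z a c) v"
        using transport_bij[OF n0(1)] good_concat[OF ab(2) _ M M'] good_number[of a c] v n0 ab c c0
        by (auto simp: bij_betw_def good_def dest!: inj_onD)
    qed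
    then show ?thesis using c0(2) by blast
  qed
  then show ?thesis using n1(1) by blast
qed

text \<open>Words that undo the permutations of \<open>I\<close> and \<open>J\<close> are put on
  top, so that both act like \<open>z\<close>. As \<open>c\<close> exceeds neither \<open>I\<close>
  nor \<open>J\<close>, its subtraction borrows nothing from the prolongation, and the contrast
  between \<open>I - c\<close> and \<open>J - c\<close> survives.\<close>

lemma balanced_block_ex:
  "\<exists>n1\<ge>n0. \<forall>a\<ge>n1. \<exists>b>a. \<exists>I J c. c \<le> I \<and> c \<le> J \<and> good a b I \<and> good a b J \<and>
    (\<forall>v\<in>A b. descend a b J v = descend a b I v) \<and> good a b (I - c) \<and>
    descend a b (J - c) ` A b \<subset> A a"
proof -
  obtain n1 where n1: "n1 \<ge> n0" and inv: "\<And>a b M. n1 \<le> a \<Longrightarrow> a \<le> b \<Longrightarrow> good a b M \<Longrightarrow>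
     \<exists>c0\<ge>b. \<forall>c\<ge>c0. \<exists>M'. good b c M' \<and>
     (\<forall>v\<in>A c. descend a c (M + height a b * M') v = descend a c (number z a c) v)"
    using inverse_word_ex by metis
  have "\<exists>b>a. \<exists>I J c. c \<le> I \<and> c \<le> J \<and> good a b I \<and> good a b J \<and>
    (\<forall>v\<in>A b. descend a b J v = descend a b I v) \<and> good a b (I - c) \<and>
    descend a b (J - c) ` A b \<subset> A a" if a: "n1 \<le> a" for a
  proof -
    obtain b I J c where b: "a < b" "c \<le> I" "c \<le> J" "good a b I" "good a b J" "good a b (I - c)"
      "descend a b (J - c) ` A b \<subset> A a"
      using block_ex[OF le_trans[OF n1 a]] by (elim exE conjE) (rule that)
    then have ab: "a \<le> b" by simp
    obtain e1 where e1: "e1 \<ge> b" "\<And>e. e \<ge> e1 \<Longrightarrow> \<exists>M'. good b e M' \<and>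
       (\<forall>v\<in>A e. descend a e (I + height a b * M') v = descend a e (number z a e) v)"
      using inv[OF a ab b(4)] by blast
    obtain e2 where e2: "e2 \<ge> b" "\<And>e. e \<ge> e2 \<Longrightarrow> \<exists>M'. good b e M' \<and>
       (\<forall>v\<in>A e. descend a e (J + height a b * M') v = descend a e (number z a e) v)"
      using inv[OF a ab b(5)] by blast
    \<comment> \<open>The two prolongations must end at a common level.\<close>
    define e where "e = max e1 e2"
    have e: "b \<le> e" "e1 \<le> e" "e2 \<le> e" using e1 e2 by (auto simp: e_def)
    obtain M1 where M1: "good b e M1"
      "\<forall>v\<in>A e. descend a e (I + height a b * M1) v = descend a e (number z a e) v"
      using e1(2)[OF e(2)] by blast
    obtain M2 where M2: "good b e M2"
      "\<forall>v\<in>A e. descend a e (J + height a b * M2) v = descend a e (number z a e) v"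
      using e2(2)[OF e(3)] by blast
    have "J - c < height a b" using b(5) by (auto simp: good_def)
    then have "descend a e (J - c + height a b * M2) ` A e = descend a b (J - c) ` descend b e M2 ` A e"
      using image_descend_split[OF ab e(1)] M2(1) by (simp add: good_def)
    then have "descend a e (J - c + height a b * M2) ` A e \<subset> A a"
      using M2(1) b(7) by (simp add: good_def)
    then have "descend a e (J + height a b * M2 - c) ` A e \<subset> A a" using b(3) by simp
    moreover have "good a e (I - c + height a b * M1)"
      by (rule good_concat[OF ab e(1) b(6) M1(1)])
    then have "good a e (I + height a b * M1 - c)" using b(2) by simp
    moreover have "c \<le> I + height a b * M1" "c \<le> J + height a b * M2" "a < e" using b e by auto
    moreover have "good a e (I + height a b * M1)" "good a e (J + height a b * M2)"
      using good_concat[OF ab e(1)] b M1(1) M2(1) by blast+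
    moreover have "\<forall>v\<in>A e. descend a e (J + height a b * M2) v = descend a e (I + height a b * M1) v"
      using M1(2) M2(2) by simp
    ultimately show ?thesis by blast
  qed
  then show ?thesis using n1 by blast
qed

text \<open>In a balanced block the words \<open>I\<close> and \<open>J\<close> act equally, so the vertices at the levels \<open>a r\<close>
  do not depend on the choice between them. By pigeonhole the bottom vertices reached through
  \<open>I - c\<close> and \<open>J - c\<close> may be assumed to be the same for infinitely many blocks.\<close>
lemma independent_descents:
  "\<exists>n1\<ge>n0. \<forall>a0\<ge>n1. \<exists>u\<in>A a0. \<exists>u'\<in>A a0. u \<noteq> u' \<and>
    (\<exists>t::nat \<Rightarrow> nat. \<forall>\<phi>::nat \<Rightarrow> bool. \<forall>R. \<exists>b\<ge>a0. \<exists>M<height a0 b. \<exists>v\<in>V b. \<forall>s<R.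
      t s \<le> M \<and> descend a0 b (M - t s) v = (if \<phi> s then u' else u))"
proof -
  obtain n1 where n1: "n1 \<ge> n0" and block: "\<And>a. n1 \<le> a \<Longrightarrow> \<exists>b>a. \<exists>I J c. c \<le> I \<and> c \<le> J \<and>
    good a b I \<and> good a b J \<and> (\<forall>v\<in>A b. descend a b J v = descend a b I v) \<and>
    good a b (I - c) \<and> descend a b (J - c) ` A b \<subset> A a"
    using balanced_block_ex by blast
  have "\<exists>u\<in>A a0. \<exists>u'\<in>A a0. u \<noteq> u' \<and>
    (\<exists>t::nat \<Rightarrow> nat. \<forall>\<phi>::nat \<Rightarrow> bool. \<forall>R. \<exists>b\<ge>a0. \<exists>M<height a0 b. \<exists>v\<in>V b. \<forall>s<R.
      t s \<le> M \<and> descend a0 b (M - t s) v = (if \<phi> s then u' else u))" if a0: "n1 \<le> a0" for a0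
  proof -
    define Q where "Q a b I J c \<longleftrightarrow> c \<le> I \<and> c \<le> J \<and>
      good a b I \<and> good a b J \<and> (\<forall>v\<in>A b. descend a b J v = descend a b I v) \<and>
      good a b (I - c) \<and> descend a b (J - c) ` A b \<subset> A a" for a b I J c
    define nxt where "nxt a = (SOME b. b > a \<and> (\<exists>I J c. Q a b I J c))" for a
    have nxt: "nxt a > a \<and> (\<exists>I J c. Q a (nxt a) I J c)" if "n1 \<le> a" for a
      unfolding nxt_def by (rule someI_ex) (use block[OF that] in \<open>unfold Q_def, blast\<close>)
    define a where "a r = (nxt ^^ r) a0" for r
    have a_ge: "n1 \<le> a r" for r
    proof (induction r)
      case (Suc r)
      then show ?case using nxt[of "a r"] by (simp add: a_def)
    qed (simp add: a_def a0)
    have a_0: "a 0 = a0" by (simp add: a_def)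
    have a_Suc: "a r < a (Suc r)" for r using nxt[OF a_ge[of r]] by (simp add: a_def)
    have a_mono: "r \<le> s \<Longrightarrow> a r \<le> a s" for r s
      using a_Suc by (meson lift_Suc_mono_le less_imp_le)
    have n0a: "n0 \<le> a r" for r using a_ge n1 le_trans by blast
    have "\<exists>I J c. Q (a r) (a (Suc r)) I J c" for r
      using nxt[OF a_ge[of r]] by (simp add: a_def)
    then obtain I J c where Q: "\<And>r. Q (a r) (a (Suc r)) (I r) (J r) (c r)" by metis
    have c_le: "c r \<le> I r" "c r \<le> J r"
      and good: "good (a r) (a (Suc r)) (I r)" "good (a r) (a (Suc r)) (J r)"
        "good (a r) (a (Suc r)) (I r - c r)"
      and same: "\<And>v. v \<in> A (a (Suc r)) \<Longrightarrow> descend (a r) (a (Suc r)) (J r) v = descend (a r) (a (Suc r)) (I r) v"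
      and proper_image: "descend (a r) (a (Suc r)) (J r - c r) ` A (a (Suc r)) \<subset> A (a r)" for r
      using Q[of r] by (auto simp: Q_def)
    have J_less: "J r - c r < height (a r) (a (Suc r))" for r
      using good(2)[of r] by (auto simp: good_def)
    define w where "w \<psi> r = (if \<psi> r then J r else I r)" for \<psi> :: "nat \<Rightarrow> bool" and r
    have good_w: "good (a r) (a (Suc r)) (w \<psi> r)" for \<psi> r using good by (simp add: w_def)
    have c_le_w: "c r \<le> w \<psi> r" for \<psi> r using c_le by (simp add: w_def)
    \<comment> \<open>The concatenation of the first \<open>r\<close> blocks, with \<open>J\<close>
      where \<psi> holds and \<open>I\<close> elsewhere.\<close>
    define M where "M \<psi> r = (\<Sum>s<r. height a0 (a s) * w \<psi> s)" for \<psi> r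
    have M_Suc: "M \<psi> (Suc r) = M \<psi> r + height a0 (a r) * w \<psi> r" for \<psi> r by (simp add: M_def)
    have a0_le: "a0 \<le> a r" for r using a_mono[of 0 r] a_0 by simp
    have good_M: "good a0 (a r) (M \<psi> r)" for \<psi> r
    proof (induction r)
      case (Suc r)
      then show ?case unfolding M_Suc
        using good_concat[OF a0_le less_imp_le[OF a_Suc] Suc good_w] by blast
    qed (simp add: M_def a_0 good_same)
    have M_less: "M \<psi> r < height a0 (a r)" for \<psi> r using good_M by (simp add: good_def)
    have descend_M_Suc: "descend a0 (a (Suc r)) (M \<psi> (Suc r)) v
        = descend a0 (a r) (M \<psi> r) (descend (a r) (a (Suc r)) (w \<psi> r) v)" for \<psi> r v
      unfolding M_Suc using good_w[of r \<psi>] M_less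
      by (intro descend_split a0_le less_imp_le[OF a_Suc]) (auto simp: good_def)
    \<comment> \<open>The action of these blocks on \<open>A (a r)\<close> does not depend on
      \<psi>; the constant choice \<open>I\<close> serves to define it.\<close>
    define \<iota> where "\<iota> r = descend a0 (a r) (M (\<lambda>_. False) r)" for r
    have \<iota>: "descend a0 (a r) (M \<psi> r) v = \<iota> r v" if "v \<in> A (a r)" for \<psi> r v
      using that
    proof (induction r arbitrary: v)
      case (Suc r)
      have "descend (a r) (a (Suc r)) (w \<psi> r) v = descend (a r) (a (Suc r)) (w (\<lambda>_. False) r) v"
        using same Suc.prems by (simp add: w_def)
      moreover have "descend (a r) (a (Suc r)) (w (\<lambda>_. False) r) v \<in> A (a r)"
        using good_w Suc.prems by (auto simp: good_def)
      ultimately show ?case using Suc.IH unfolding \<iota>_def descend_M_Suc by simp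
    qed (simp add: \<iota>_def M_def)
    have \<iota>_bij: "bij_betw (\<iota> r) (A (a r)) (A a0)" for r
      unfolding \<iota>_def using good_bij[OF _ a0_le good_M] n0a[of 0] a_0 by simp
    have \<iota>_inj: "\<iota> r v = \<iota> r v' \<Longrightarrow> v \<in> A (a r) \<Longrightarrow> v' \<in> A (a r) \<Longrightarrow> v = v'" for r v v'
      using \<iota>_bij[of r] by (auto simp: bij_betw_def dest: inj_onD)
    have \<iota>_in: "v \<in> A (a r) \<Longrightarrow> \<iota> r v \<in> A a0" for r v
      using \<iota>_bij[of r] by (auto simp: bij_betw_def)
    have I_in: "descend (a r) (a (Suc r)) (I r - c r) v \<in> A (a r)"
      and J_in: "descend (a r) (a (Suc r)) (J r - c r) v \<in> A (a r)" if "v \<in> A (a (Suc r))" for r v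
      using good(3)[of r] proper_image[of r] that by (auto simp: good_def)
    \<comment> \<open>One of the two translated words is onto \<open>A (a r)\<close> and the other
      is not, so they differ at some vertex \<open>q r\<close>.\<close>
    have "\<exists>v\<in>A (a (Suc r)). descend (a r) (a (Suc r)) (I r - c r) v \<noteq> descend (a r) (a (Suc r)) (J r - c r) v" for r
    proof (rule ccontr)
      assume "\<not> ?thesis"
      then have "descend (a r) (a (Suc r)) (I r - c r) ` A (a (Suc r)) = descend (a r) (a (Suc r)) (J r - c r) ` A (a (Suc r))"
        by (intro image_cong) auto
      then show False using good(3)[of r] proper_image[of r] by (simp add: good_def)
    qed
    then obtain q where q: "\<And>r. q r \<in> A (a (Suc r))"
      "\<And>r. descend (a r) (a (Suc r)) (I r - c r) (q r) \<noteq> descend (a r) (a (Suc r)) (J r - c r) (q r)"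
      by metis
    \<comment> \<open>The type of a block: the entering vertex and the two outcomes, all moved into
      the one finite set \<open>A a0\<close> to allow the pigeonhole argument.\<close>
    define F where "F r = (\<iota> (Suc r) (q r), \<iota> r (descend (a r) (a (Suc r)) (I r - c r) (q r)),
      \<iota> r (descend (a r) (a (Suc r)) (J r - c r) (q r)))" for r
    have F_in: "F r \<in> A a0 \<times> A a0 \<times> A a0" for r
      using q(1) I_in J_in \<iota>_in by (simp add: F_def)
    have "finite (A a0)" using finite_A n0a[of 0] a_0 by simp
    then have "finite (range F)" using F_in finite_subset[of "range F" "A a0 \<times> A a0 \<times> A a0"] by blast
    then obtain r0 where "infinite {r \<in> UNIV. F r = F r0}" using pigeonhole_infinite by blast
    then have inf: "infinite {r. F r = F r0}" (is "infinite ?S") by simp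
    obtain \<alpha> u u' where F0: "F r0 = (\<alpha>, u, u')" by (cases "F r0")
    have \<alpha>: "\<alpha> \<in> A a0" and u: "u \<in> A a0" "u' \<in> A a0" using F_in[of r0] F0 by auto
    have "u \<noteq> u'" using F0 \<iota>_inj[OF _ I_in[OF q(1)] J_in[OF q(1)]] q(2) by (auto simp: F_def)
    define e where "e = enumerate ?S"
    have e_in: "F (e s) = F r0" for s using enumerate_in_set[OF inf, of s] by (simp add: e_def)
    have e_inj: "e s = e s' \<longleftrightarrow> s = s'" for s s' using inj_enumerate[OF inf] by (auto simp: e_def inj_def)
    have e_mono: "s < R \<Longrightarrow> e s < e R" for s R using enumerate_mono[OF _ inf] by (simp add: e_def)
    \<comment> \<open>The offset depends only on the block and its \<open>c\<close>, so one sequence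
      serves every \<phi>.\<close>
    define t where "t s = height a0 (a (e s)) * c (e s)" for s
    have "\<exists>b\<ge>a0. \<exists>M<height a0 b. \<exists>v\<in>V b. \<forall>s<R.
      t s \<le> M \<and> descend a0 b (M - t s) v = (if \<phi> s then u' else u)" for \<phi> R
    proof -
      define \<psi> where "\<psi> r \<longleftrightarrow> (\<exists>s. r = e s \<and> \<phi> s)" for r
      have \<psi>: "\<psi> (e s) = \<phi> s" for s using e_inj by (auto simp: \<psi>_def)
      \<comment> \<open>Because \<iota> is independent of the choices, starting at the vertex that
        corresponds to \<alpha> makes the descent enter each block \<open>e s\<close> with
        \<open>s < R\<close> at \<open>q (e s)\<close>.\<close>
      obtain v where v: "v \<in> A (a (e R))" "\<iota> (e R) v = \<alpha>"
        using \<iota>_bij[of "e R"] \<alpha> by (metis bij_betw_imp_surj_on imageE)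
      have "t s \<le> M \<psi> (e R) \<and> descend a0 (a (e R)) (M \<psi> (e R) - t s) v = (if \<phi> s then u' else u)"
        if "s < R" for s
      proof -
        define r where "r = e s"
        have rR: "Suc r \<le> e R" using e_mono[OF that] by (simp add: r_def)
        \<comment> \<open>The part of the word above block \<open>r\<close> is split off as the high
          word \<open>N\<close>.\<close>
        have "\<exists>N. M \<psi> r' = M \<psi> (Suc r) + height a0 (a (Suc r)) * N \<and> good (a (Suc r)) (a r') N"
          if "Suc r \<le> r'" for r'
          using that
        proof (induction r' rule: nat_induct_at_least)
          case (Suc r')
          then obtain N where N: "M \<psi> r' = M \<psi> (Suc r) + height a0 (a (Suc r)) * N"
            "good (a (Suc r)) (a r') N" by blast
          have "height a0 (a r') = height a0 (a (Suc r)) * height (a (Suc r)) (a r')"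
            using a0_le a_mono Suc by (intro height_split) auto
          then have "M \<psi> (Suc r') = M \<psi> (Suc r) + height a0 (a (Suc r)) * (N + height (a (Suc r)) (a r') * w \<psi> r')"
            unfolding M_Suc[of \<psi> r'] N by (simp add: distrib_left)
          moreover have "good (a (Suc r)) (a (Suc r')) (N + height (a (Suc r)) (a r') * w \<psi> r')"
            using good_concat[OF _ _ N(2) good_w] a_mono Suc by simp
          ultimately show ?case by blast
        qed (use good_same in auto)
        then obtain N where N: "M \<psi> (e R) = M \<psi> (Suc r) + height a0 (a (Suc r)) * N"
            "good (a (Suc r)) (a (e R)) N" using rR by blast
        define v' where "v' = descend (a (Suc r)) (a (e R)) N v"
        have v': "v' \<in> A (a (Suc r))" using v N by (auto simp: v'_def good_def)
        have le: "a (Suc r) \<le> a (e R)" using a_mono rR by blast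
        have split: "descend a0 (a (e R)) (N' + height a0 (a (Suc r)) * N) v = descend a0 (a (Suc r)) N' v'"
          if "N' < height a0 (a (Suc r))" for N'
          unfolding v'_def using that N(2) le a0_le by (intro descend_split) (auto simp: good_def)
        have "\<iota> (Suc r) v' = \<alpha>" using split[OF M_less] N(1) \<iota>[OF v(1)] \<iota>[OF v'] v(2) by metis
        moreover have Fr: "F r = (\<alpha>, u, u')" using e_in F0 by (simp add: r_def)
        ultimately have "v' = q r" using \<iota>_inj[OF _ v' q(1)] by (simp add: F_def)
        \<comment> \<open>Since \<open>c r\<close> is at most the word of block \<open>r\<close>,
          the subtraction is confined to this block.\<close>
        have "height a0 (a r) * c r \<le> height a0 (a r) * w \<psi> r" using c_le_w by simp
        then have le_M: "t s \<le> M \<psi> (Suc r)"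
          and sub: "M \<psi> (Suc r) - t s = M \<psi> r + height a0 (a r) * (w \<psi> r - c r)"
          unfolding M_Suc t_def r_def[symmetric] diff_mult_distrib2 by linarith+
        have wc: "w \<psi> r - c r < height (a r) (a (Suc r))"
          using good_w[of r \<psi>] by (auto simp: good_def)
        have wc_in: "descend (a r) (a (Suc r)) (w \<psi> r - c r) v' \<in> A (a r)"
          using I_in[OF v'] J_in[OF v'] by (simp add: w_def)
        have "descend a0 (a (e R)) (M \<psi> (e R) - t s) v = descend a0 (a (e R)) ((M \<psi> (Suc r) - t s) + height a0 (a (Suc r)) * N) v"
          using N(1) le_M by simp
        also have "\<dots> = descend a0 (a (Suc r)) (M \<psi> (Suc r) - t s) v'"
          using M_less[of \<psi> "Suc r"] by (intro split) auto
        also have "\<dots> = descend a0 (a r) (M \<psi> r) (descend (a r) (a (Suc r)) (w \<psi> r - c r) v')"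
          unfolding sub using M_less wc by (intro descend_split a0_le less_imp_le[OF a_Suc]) auto
        also have "\<dots> = \<iota> r (descend (a r) (a (Suc r)) (w \<psi> r - c r) v')"
          by (rule \<iota>[OF wc_in])
        also have "\<dots> = (if \<phi> s then u' else u)"
          using \<psi>[of s] Fr \<open>v' = q r\<close> by (simp add: F_def w_def r_def)
        finally show ?thesis using le_M N(1) by simp
      qed
      moreover have "v \<in> V (a (e R))" using v(1) A_subset[OF n0a] by blast
      ultimately show ?thesis using M_less a0_le by blast
    qed
    then show ?thesis using u \<open>u \<noteq> u'\<close> by blast
  qed
  then show ?thesis using n1 by blast
qed

text \<open>Choosing the larger of the two labels at a high level and the smaller one at the next level
  keeps the word away from both ends of its tower.\<close>
lemma interior_word_ex:
  "\<exists>m0\<ge>n0. \<forall>m\<ge>m0. \<exists>M. good n0 m M \<and> K \<le> height 0 n0 * M \<and> height 0 n0 * (M + 1) + K \<le> height 0 m"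
proof -
  \<comment> \<open>Two different labels at each level make every \<open>l\<close> at least 2 from
    \<open>n0\<close> on, so the heights outgrow \<open>K\<close>.\<close>
  have hK: "K < height n0 (n0 + j)" if "K \<le> j" for j
  proof -
    have "j < height n0 (n0 + j)" for j
    proof (induction j)
      case (Suc j)
      have "2 \<le> l (n0 + j)" using z_less[of "n0 + j"] y_less[of "n0 + j"] z_neq_y[of "n0 + j"] by linarith
      then have "height n0 (n0 + j) * 2 \<le> height n0 (n0 + Suc j)" by (simp add: height_Suc)
      then show ?case using Suc by linarith
    qed simp
    then show ?thesis using that le_less_trans by blast
  qed
  define n where "n = n0 + K"
  define hi where "hi = max (z n) (y n)"
  define lo where "lo = min (z (Suc n)) (y (Suc n))"
  have n: "n0 \<le> n" by (simp add: n_def)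
  have hi: "good n (Suc n) hi" "1 \<le> hi" using good_step[OF n] z_neq_y[OF n] by (auto simp: hi_def max_def)
  have lo: "good (Suc n) (Suc (Suc n)) lo" "Suc lo < l (Suc n)"
    using good_step[of "Suc n"] z_neq_y[of "Suc n"] z_less[of "Suc n"] y_less[of "Suc n"] n
    by (auto simp: lo_def min_def)
  have "\<exists>M. good n0 m M \<and> K \<le> height 0 n0 * M \<and> height 0 n0 * (M + 1) + K \<le> height 0 m"
    if m: "Suc (Suc n) \<le> m" for m
  proof -
    define Z where "Z = number z n0 n"
    define Z' where "Z' = number z (Suc (Suc n)) m"
    have Z: "good n0 n Z" and Z': "good (Suc (Suc n)) m Z'" using good_number n m by (auto simp: Z_def Z'_def)
    define L where "L = Z + height n0 n * hi"
    have L: "good n0 (Suc n) L" unfolding L_def using good_concat[OF n _ Z hi(1)] by simp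
    define L' where "L' = L + height n0 (Suc n) * lo"
    have L': "good n0 (Suc (Suc n)) L'" unfolding L'_def using good_concat[OF _ _ L lo(1)] n by simp
    define M where "M = L' + height n0 (Suc (Suc n)) * Z'"
    have M: "good n0 m M" unfolding M_def using good_concat[OF _ m L' Z'] n by simp
    have h: "height 0 n0 \<ge> 1" using height_pos[of 0 n0] by linarith
    have "K < height n0 n" using hK[of K] by (simp add: n_def)
    also have "\<dots> \<le> height n0 n * hi" using hi by simp
    finally have "K \<le> M" unfolding M_def L'_def L_def by linarith
    then have 1: "K \<le> height 0 n0 * M" using h by (metis le_trans mult_le_mono1 mult_1)
    \<comment> \<open>As \<open>lo\<close> is at most \<open>l (Suc n) - 2\<close>, a full stretch
      of length \<open>height n0 (Suc n)\<close> remains above the word.\<close>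
    have "L' + 1 + height n0 (Suc n) \<le> height n0 (Suc n) * (lo + 2)"
      using L by (simp add: L'_def good_def)
    also have "\<dots> \<le> height n0 (Suc n) * l (Suc n)" using lo by (intro mult_le_mono2) simp
    also have "\<dots> = height n0 (Suc (Suc n))" using n by (simp add: height_Suc)
    finally have "L' + 1 + height n0 (Suc n) \<le> height n0 (Suc (Suc n))" .
    moreover have "K < height n0 (Suc n)" using hK[of "Suc K"] by (simp add: n_def)
    ultimately have "M + 1 + K \<le> height n0 (Suc (Suc n)) * Suc Z'" by (simp add: M_def)
    also have "\<dots> \<le> height n0 (Suc (Suc n)) * height (Suc (Suc n)) m"
      using Z' by (intro mult_le_mono2) (simp add: good_def)
    also have "\<dots> = height n0 m" using n m by (intro height_split[symmetric]) auto
    finally have "height 0 n0 * (M + 1 + K) \<le> height 0 n0 * height n0 m" by (rule mult_le_mono2)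
    also have "\<dots> = height 0 m" using n m by (intro height_split[symmetric]) auto
    finally have "height 0 n0 * (M + 1 + K) \<le> height 0 m" .
    moreover have "1 * K \<le> height 0 n0 * K" by (intro mult_le_mono1 h)
    ultimately have "height 0 n0 * (M + 1) + K \<le> height 0 m" unfolding distrib_left by linarith
    then show ?thesis using M 1 by blast
  qed
  then show ?thesis using n by (intro exI[of _ "Suc (Suc n)"]) auto
qed

end

section \<open>Extracting a spine from the double path\<close>

context toeplitz_diagram
begin

lemma extended_edge_iff:
  "(C, i, D) \<in> edges (extended_diagram B) n \<longleftrightarrow>
    C \<noteq> {} \<and> C \<subseteq> V n \<and> D \<noteq> {} \<and> D \<subseteq> V (Suc n) \<and> i < l n \<and> theta B i ` D = C"
  by (simp add: extended_diagram_def)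

text \<open>All but countably many of the label sequences obtained from the two paths have an eventual
  range of the essential thickness, which then coincides with the vertices of the double path.\<close>
lemma thick_spine_ex:
  assumes "thick_BV B"
  shows "\<exists>A z y n0 k. thick_spine B A z y n0 k"
proof -
  let ?D = "extended_diagram B"
  obtain k' \<gamma> \<gamma>' where k': "is_essential_thickness B k'" "1 < k'" "k' < \<infinity>"
    and double: "double_path B \<gamma> \<gamma>'" and thick: "\<gamma> \<in> paths_of_thickness B k'"
    using assms by (auto simp: thick_BV_def)
  obtain k where k: "k' = enat k" using k'(3) by (cases k') auto
  have k_ge: "2 \<le> k" using k'(2) by (simp add: k one_enat_def)
  define A where "A n = src ?D (\<gamma> n)" for n
  define i where "i n = label ?D (\<gamma> n)" for n
  define j where "j n = label ?D (\<gamma>' n)" for n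
  have paths: "\<gamma> \<in> paths ?D" "\<gamma>' \<in> paths ?D" using double by (auto simp: double_path_def)
  have edge: "\<delta> n = (src ?D (\<delta> n), label ?D (\<delta> n), src ?D (\<delta> (Suc n))) \<and> \<delta> n \<in> edges ?D n"
    if "\<delta> \<in> paths ?D" for \<delta> n
  proof -
    have "rng ?D (\<delta> n) = src ?D (\<delta> (Suc n))" "\<delta> n \<in> edges ?D n" using that by (auto simp: paths_def)
    then show ?thesis by (cases "\<delta> n") (auto simp: extended_diagram_def)
  qed
  have A: "A n \<noteq> {}" "A n \<subseteq> V n" "i n < l n" "theta B (i n) ` A (Suc n) = A n" for n
    using edge[OF paths(1), of n] extended_edge_iff unfolding A_def i_def by metis+
  have parallel: "src ?D (\<gamma>' n) = A n" "j n \<noteq> i n" if "n > 0" for n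
    using double that unfolding double_path_def parallel_edges_def Let_def A_def i_def j_def by metis+
  have j: "j n < l n" "theta B (j n) ` A (Suc n) = A n" if "n > 0" for n
    using edge[OF paths(2), of n] extended_edge_iff parallel[OF that] parallel[of "Suc n"]
    unfolding j_def by (metis zero_less_Suc)+
  have "\<forall>\<^sub>F n in sequentially. card (A n) = k"
    using thick by (simp add: paths_of_thickness_def k A_def)
  then obtain N0 where N0: "\<And>n. n \<ge> N0 \<Longrightarrow> card (A n) = k"
    by (auto simp: eventually_sequentially)
  \<comment> \<open>The choice starts at level 1, because the two edges at level 0 may
    coincide.\<close>
  define z where "z \<eta> n = (case n of 0 \<Rightarrow> i 0 | Suc m \<Rightarrow> (if \<eta> m then j n else i n))" for \<eta> n
  have z: "z \<eta> n < l n" "theta B (z \<eta> n) ` A (Suc n) = A n" for \<eta> n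
    using A(3,4)[of n] j[of n] by (auto simp: z_def split: nat.split)
  define R where "R \<eta> = finite_inverse_system.eventual_range V (\<lambda>n. theta B (z \<eta> n))" for \<eta>
  have sys: "finite_inverse_system V (\<lambda>n. theta B (z \<eta> n))" for \<eta>
    using finite_V V_nonempty theta_in z(1) by unfold_locales auto
  have A_R: "A n \<subseteq> R \<eta> n" for \<eta> n
    unfolding R_def using A(2) z(2) by (intro finite_inverse_system.subset_eventual_range[OF sys])
  \<comment> \<open>The eventual ranges, joined by the chosen labels, form a path of the extended
    diagram; different choices give different labels and hence different paths.\<close>
  define P where "P \<eta> n = (R \<eta> n, z \<eta> n, R \<eta> (Suc n))" for \<eta> n
  have R_props: "R \<eta> n \<noteq> {}" "R \<eta> n \<subseteq> V n" "theta B (z \<eta> n) ` R \<eta> (Suc n) = R \<eta> n" for \<eta> n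
    unfolding R_def using finite_inverse_system.eventual_range_nonempty[OF sys]
      finite_inverse_system.eventual_range_subset[OF sys]
      finite_inverse_system.image_eventual_range[OF sys] by auto
  have "P \<eta> n \<in> edges ?D n" for \<eta> n
    using R_props[of \<eta>] z(1)[of \<eta> n] by (simp add: P_def extended_edge_iff)
  then have P_path: "P \<eta> \<in> paths ?D" for \<eta>
    by (auto simp: paths_def P_def extended_diagram_def)
  have src_P: "src ?D (P \<eta> n) = R \<eta> n" for \<eta> n by (simp add: P_def extended_diagram_def)
  have "inj P"
  proof (rule injI, rule ext)
    fix \<eta> \<eta>' m assume "P \<eta> = P \<eta>'"
    then have "z \<eta> (Suc m) = z \<eta>' (Suc m)" by (metis P_def prod.inject)
    then show "\<eta> m = \<eta>' m" using parallel(2)[of "Suc m"] by (auto simp: z_def split: if_splits)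
  qed
  have "\<exists>\<eta>. P \<eta> \<in> paths_of_thickness B (enat k)"
  proof (rule ccontr)
    assume none: "\<nexists>\<eta>. P \<eta> \<in> paths_of_thickness B (enat k)"
    \<comment> \<open>Eventual ranges contain the sets \<open>A n\<close>, so a thickness other than
      \<open>k\<close> is larger than \<open>k\<close>, possibly infinite. There are only countably
      many such paths.\<close>
    have "P \<eta> \<in> (\<Union>m\<in>{m. k' < m}. paths_of_thickness B m)" for \<eta>
    proof (cases "\<exists>m. \<forall>\<^sub>F n in sequentially. card (R \<eta> n) = m")
      case True
      then obtain m where m: "\<forall>\<^sub>F n in sequentially. card (R \<eta> n) = m" by blast
      then have mem: "P \<eta> \<in> paths_of_thickness B (enat m)"
        using P_path by (simp add: paths_of_thickness_def src_P)
      obtain N where "\<And>n. n \<ge> N \<Longrightarrow> card (R \<eta> n) = m" using m by (auto simp: eventually_sequentially)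
      then have "card (R \<eta> (max N N0)) = m" by simp
      moreover have "card (A (max N N0)) \<le> card (R \<eta> (max N N0))"
        using R_props(2) finite_V finite_subset by (intro card_mono A_R) blast
      ultimately have "k \<le> m" using N0[of "max N N0"] by simp
      moreover have "m \<noteq> k" using none mem by blast
      ultimately show ?thesis using mem by (intro UN_I[of "enat m"]) (auto simp: k)
    next
      case False
      then have "P \<eta> \<in> paths_of_thickness B \<infinity>"
        using P_path by (simp add: paths_of_thickness_def src_P)
      then show ?thesis using k by (intro UN_I[of \<infinity>]) auto
    qed
    then have "range P \<subseteq> (\<Union>m\<in>{m. k' < m}. paths_of_thickness B m)" by blast
    moreover have "countable (paths_of_thickness B m)" if "k' < m" for m
      using k'(1) that unfolding is_essential_thickness_def by (metis not_le)
    then have "countable (\<Union>m\<in>{m. k' < m}. paths_of_thickness B m)"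
      by (intro countable_UN) auto
    ultimately have "countable (range P)" using countable_subset by blast
    then show False using uncountable_bool_sequences \<open>inj P\<close> countable_image_inj_eq by blast
  qed
  then obtain \<eta> where "P \<eta> \<in> paths_of_thickness B (enat k)" by blast
  then have "\<forall>\<^sub>F n in sequentially. card (R \<eta> n) = k"
    by (simp add: paths_of_thickness_def src_P)
  then obtain N where N: "\<And>n. n \<ge> N \<Longrightarrow> card (R \<eta> n) = k" by (auto simp: eventually_sequentially)
  \<comment> \<open>\<open>Suc\<close> excludes level 0, where the edges need not be
    parallel.\<close>
  define n0 where "n0 = Suc (max N N0)"
  have AR: "R \<eta> n = A n" if "n \<ge> n0" for n
  proof (rule card_subset_eq[symmetric])
    show "finite (R \<eta> n)" using R_props(2) finite_V finite_subset by blast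
    show "card (A n) = card (R \<eta> n)" using N[of n] N0[of n] that by (simp add: n0_def)
  qed (rule A_R)
  \<comment> \<open>Whichever of the two parallel labels \<open>z\<close> has not taken.\<close>
  define y where "y n = (if z \<eta> n = i n then j n else i n)" for n
  have "thick_spine B A (z \<eta>) y n0 k"
  proof unfold_locales
    fix n assume n: "n0 \<le> n"
    then have n': "n > 0" by (simp add: n0_def)
    show "A n \<subseteq> V n" by (rule A)
    show "card (A n) = k" using N0[of n] n by (simp add: n0_def)
    show "z \<eta> n < l n" "theta B (z \<eta> n) ` A (Suc n) = A n" by (rule z)+
    show "y n < l n" "theta B (y n) ` A (Suc n) = A n" using A j[OF n'] by (auto simp: y_def)
    show "z \<eta> n \<noteq> y n" using parallel(2)[OF n'] by (auto simp: y_def)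
    obtain m where m: "m \<ge> n" "compose_maps (\<lambda>n. theta B (z \<eta> n)) n m ` V m = R \<eta> n"
      using finite_inverse_system.eventual_range_attained[OF sys, of n \<eta>] unfolding R_def by blast
    moreover have "descend n m (number (z \<eta>) n m) = compose_maps (\<lambda>n. theta B (z \<eta> n)) n m"
      using descend_number z(1) by blast
    ultimately show "\<exists>m\<ge>n. descend n m (number (z \<eta>) n m) ` V m = A n" using AR[OF n] by metis
  qed (rule k_ge)
  then show ?thesis by blast
qed

end

section \<open>Coordinates of the shift\<close>

text \<open>A continuous map to a discrete space is constant on a cylinder around each point;
  finitely many cylinders cover the compact space, and their coordinates together suffice.
  Compactness is assumed because for the path space it is inherited from the shift.\<close>

lemma finitely_many_coordinates:
  fixes E :: "'i \<Rightarrow> 'a set" and S and f :: "('i \<Rightarrow> 'a) \<Rightarrow> 'b"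
  defines "T \<equiv> subtopology (product_topology (\<lambda>i. discrete_topology (E i)) UNIV) S"
  assumes compact: "compact_space T" and sub: "S \<subseteq> (\<Pi>\<^sub>E i\<in>UNIV. E i)"
    and cont: "continuous_map T (discrete_topology D) f"
  shows "\<exists>J. finite J \<and> (\<forall>x\<in>S. \<forall>y\<in>S. (\<forall>i\<in>J. x i = y i) \<longrightarrow> f x = f y)"
proof -
  have top: "topspace T = S" using sub by (auto simp: T_def)
  define C where "C J x = {y \<in> S. \<forall>i\<in>J. y i = x i}" for J and x :: "'i \<Rightarrow> 'a"
  have "\<exists>J. finite J \<and> C J x \<subseteq> {y \<in> S. f y = f x}" if x: "x \<in> S" for x
  proof -
    have "f x \<in> D" using continuous_map_image_subset_topspace[OF cont] x top by auto
    then have "openin T {y \<in> S. f y = f x}"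
      using openin_continuous_map_preimage[OF cont, of "{f x}"] by (simp add: top)
    then obtain U where U: "openin (product_topology (\<lambda>i. discrete_topology (E i)) UNIV) U"
      "{y \<in> S. f y = f x} = U \<inter> S" unfolding T_def openin_subtopology by blast
    then have "x \<in> U" using x by blast
    then obtain W where W: "finite {i. W i \<noteq> E i}" "x \<in> Pi\<^sub>E UNIV W" "Pi\<^sub>E UNIV W \<subseteq> U"
      using U(1) by (auto simp: openin_product_topology_alt)
    have "C {i. W i \<noteq> E i} x \<subseteq> Pi\<^sub>E UNIV W"
    proof
      fix y assume y: "y \<in> C {i. W i \<noteq> E i} x"
      have "y i \<in> W i" for i
        using y W(2) sub by (cases "W i = E i") (auto simp: C_def PiE_def Pi_def)
      then show "y \<in> Pi\<^sub>E UNIV W" by (auto simp: PiE_iff)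
    qed
    then have "C {i. W i \<noteq> E i} x \<subseteq> {y \<in> S. f y = f x}" using U(2) W(3) by (auto simp: C_def)
    then show ?thesis using W(1) by blast
  qed
  then obtain J where J: "\<And>x. x \<in> S \<Longrightarrow> finite (J x)" "\<And>x. x \<in> S \<Longrightarrow> C (J x) x \<subseteq> {y \<in> S. f y = f x}"
    by metis
  have "openin T (C (J x) x)" if x: "x \<in> S" for x
  proof -
    let ?W = "\<lambda>i. if i \<in> J x then {x i} else E i"
    have "finite {i. ?W i \<noteq> topspace (discrete_topology (E i))}"
      using J(1)[OF x] by (rule rev_finite_subset) auto
    then have "openin (product_topology (\<lambda>i. discrete_topology (E i)) UNIV) (Pi\<^sub>E UNIV ?W)"
      using x sub by (intro product_topology_basis) auto
    moreover have "C (J x) x = Pi\<^sub>E UNIV ?W \<inter> S"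
      using sub by (auto simp: C_def PiE_def Pi_def split: if_splits)
    ultimately show ?thesis by (auto simp: T_def openin_subtopology)
  qed
  moreover have "\<Union>((\<lambda>x. C (J x) x) ` S) = topspace T" by (auto simp: C_def top)
  ultimately obtain \<F> where \<F>: "finite \<F>" "\<F> \<subseteq> (\<lambda>x. C (J x) x) ` S" "\<Union>\<F> = S"
    using compact[unfolded compact_space, rule_format, of "(\<lambda>x. C (J x) x) ` S"] by (auto simp: top)
  then obtain P where P: "finite P" "P \<subseteq> S" "\<F> = (\<lambda>x. C (J x) x) ` P"
    by (meson finite_subset_image)
  have "f x = f y" if xy: "x \<in> S" "y \<in> S" "\<forall>i\<in>\<Union>(J ` P). x i = y i" for x y
  proof -
    obtain p where p: "p \<in> P" "x \<in> C (J p) p" using \<F>(3) P(3) xy(1) by blast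
    then have "y \<in> C (J p) p" using xy by (force simp: C_def)
    moreover have "C (J p) p \<subseteq> {y \<in> S. f y = f p}" using p(1) P(2) J(2) by blast
    ultimately have "x \<in> {y \<in> S. f y = f p}" "y \<in> {y \<in> S. f y = f p}" using p(2) by blast+
    then show ?thesis by simp
  qed
  moreover have "finite (\<Union>(J ` P))" using P J(1) by blast
  ultimately show ?thesis by blast
qed

lemma
  assumes "is_shift K X"
  shows compact_shift: "compact_space (shift_topology K X)"
    and shift_subset: "X \<subseteq> (\<Pi>\<^sub>E i\<in>UNIV. K)"
    and topspace_shift: "topspace (shift_topology K X) = X"
proof -
  have "compact_space (full_shift_topology K)"
    using assms by (auto simp: is_shift_def full_shift_topology_def compact_space_product_topology
        compact_space_discrete_topology)
  then show "compact_space (shift_topology K X)"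
    using assms by (auto simp: is_shift_def shift_topology_def intro: closedin_compact_space compact_space_subtopology)
  have "X \<subseteq> topspace (full_shift_topology K)"
    using assms closedin_subset by (auto simp: is_shift_def)
  then show "X \<subseteq> (\<Pi>\<^sub>E i\<in>UNIV. K)" "topspace (shift_topology K X) = X"
    by (auto simp: full_shift_topology_def shift_topology_def)
qed

text \<open>The first \<open>R\<close> constraints cut out nested nonempty closed subsets of a
  compact space.\<close>

lemma shift_coordinates_compactness:
  assumes shift: "is_shift K X" and ex: "\<And>R. \<exists>x\<in>X. \<forall>s<R. x (t s) \<in> W s" and W: "\<And>s. W s \<subseteq> K"
  shows "\<exists>x\<in>X. \<forall>s::nat. x (t s) \<in> W s"
proof -
  let ?T = "shift_topology K X"
  define C where "C R = {x \<in> X. \<forall>s<R. x (t s) \<in> W s}" for R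
  have cl: "closedin ?T {x \<in> X. x (t s) \<in> W s}" for s
  proof -
    have "continuous_map ?T (discrete_topology K) (\<lambda>x. x (t s))"
      unfolding shift_topology_def full_shift_topology_def
      by (intro continuous_map_from_subtopology continuous_map_product_projection) simp
    then have "closedin ?T {x \<in> topspace ?T. x (t s) \<in> W s}"
      by (rule closedin_continuous_map_preimage) (simp add: W)
    then show ?thesis using topspace_shift[OF shift] by simp
  qed
  have "closedin ?T (C R)" for R
  proof (induction R)
    case 0
    have "C 0 = topspace ?T" using topspace_shift[OF shift] by (simp add: C_def)
    then show ?case by (simp only: closedin_topspace)
  next
    case (Suc R)
    have "C (Suc R) = C R \<inter> {x \<in> X. x (t R) \<in> W R}" by (auto simp: C_def less_Suc_eq)
    then show ?case using Suc cl by auto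
  qed
  moreover have "C R \<noteq> {}" for R using ex by (auto simp: C_def)
  moreover have "decseq C" by (auto simp: decseq_def C_def)
  ultimately have "(\<Inter>n. C n) \<noteq> {}" by (intro compact_space_imp_nest[OF compact_shift[OF shift]]) auto
  then obtain x where "\<And>n. x \<in> C n" by blast
  then show ?thesis by (auto simp: C_def intro!: bexI[of _ x])
qed

section \<open>Reading tower positions of points of the shift through the conjugacy\<close>

locale shift_of_diagram = toeplitz_diagram B for B :: "('v, 'e) bratteli" +
  fixes K :: "'a set" and X :: "(int \<Rightarrow> 'a) set" and h :: "(int \<Rightarrow> 'a) \<Rightarrow> nat \<Rightarrow> 'e"
  assumes shift: "is_shift K X"
    and homeo: "homeomorphic_map (shift_topology K X) (path_topology B) h"
    and equivariant: "x \<in> X \<Longrightarrow> h (shift_map x) = vershik B (h x)"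
begin

lemma paths_subset: "paths B \<subseteq> (\<Pi>\<^sub>E n\<in>UNIV. edges B n)"
  by (auto simp: paths_def)

lemma topspace_paths: "topspace (path_topology B) = paths B"
  using paths_subset by (auto simp: path_topology_def)

lemma h_bij: "bij_betw h X (paths B)"
  using homeo topspace_shift[OF shift] topspace_paths
  by (simp add: bij_betw_def homeomorphic_eq_everything_map)

lemma h_in: "x \<in> X \<Longrightarrow> h x \<in> paths B"
  using h_bij by (auto simp: bij_betw_def)

lemma h_inj: "x \<in> X \<Longrightarrow> x' \<in> X \<Longrightarrow> h x = h x' \<Longrightarrow> x = x'"
  using h_bij by (auto simp: bij_betw_def dest: inj_onD)

text \<open>Continuity of the inverse conjugacy: one letter depends on finitely many edges, hence on
  an initial segment.\<close>

lemma letter_determined: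
  "\<exists>m. \<forall>x\<in>X. \<forall>x'\<in>X. (\<forall>i<m. h x i = h x' i) \<longrightarrow> x 0 = x' 0"
proof -
  obtain g where g: "homeomorphic_maps (shift_topology K X) (path_topology B) h g"
    using homeo homeomorphic_map_maps by blast
  have gh: "g (h x) = x" if "x \<in> X" for x
    using g that topspace_shift[OF shift] by (auto simp: homeomorphic_maps_def)
  have "continuous_map (shift_topology K X) (discrete_topology K) (\<lambda>x. x 0)"
    unfolding shift_topology_def full_shift_topology_def
    by (intro continuous_map_from_subtopology continuous_map_product_projection) simp
  then have cont: "continuous_map (path_topology B) (discrete_topology K) ((\<lambda>x. x 0) \<circ> g)"
    using g by (intro continuous_map_compose) (auto simp: homeomorphic_maps_def)
  have "compact_space (path_topology B)"
    using homeomorphic_compact_space compact_shift[OF shift] homeo homeomorphic_map_imp_homeomorphic_space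
    by blast
  then obtain J where J: "finite J"
    "\<And>x y. x \<in> paths B \<Longrightarrow> y \<in> paths B \<Longrightarrow> (\<forall>i\<in>J. x i = y i) \<Longrightarrow> g x 0 = g y 0"
    using finitely_many_coordinates[OF _ paths_subset cont[unfolded path_topology_def]]
    unfolding path_topology_def o_def by blast
  obtain m where "J \<subseteq> {..<m}" using J(1) finite_nat_iff_bounded by auto
  then show ?thesis using J(2)[OF h_in h_in] gh by (intro exI[of _ m]) (metis lessThan_iff subsetD)
qed

text \<open>Continuity of the conjugacy itself: one edge depends on a finite window of
  letters.\<close>

lemma edge_determined:
  "\<exists>J. finite J \<and> (\<forall>x\<in>X. \<forall>x'\<in>X. (\<forall>s\<in>J. x s = x' s) \<longrightarrow> h x n = h x' n)"
proof -
  have "continuous_map (path_topology B) (discrete_topology (edges B n)) (\<lambda>x. x n)"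
    unfolding path_topology_def
    by (intro continuous_map_from_subtopology continuous_map_product_projection) simp
  then have "continuous_map (shift_topology K X) (discrete_topology (edges B n)) ((\<lambda>x. x n) \<circ> h)"
    using homeomorphic_imp_continuous_map[OF homeo] continuous_map_compose by blast
  then show ?thesis
    using finitely_many_coordinates[of "\<lambda>_. K" X "edges B n" "(\<lambda>x. x n) \<circ> h"]
      compact_shift[OF shift] shift_subset[OF shift]
    by (simp add: shift_topology_def full_shift_topology_def)
qed

definition translate :: "int \<Rightarrow> (int \<Rightarrow> 'a) \<Rightarrow> int \<Rightarrow> 'a" where
  "translate t x = (\<lambda>n. x (n + t))"

lemma shift_map_in: "x \<in> X \<Longrightarrow> shift_map x \<in> X"
  using shift by (auto simp: is_shift_def)

lemma shift_translate: "shift_map (translate t x) = translate (t + 1) x"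
  by (simp add: shift_map_def translate_def add.commute add.left_commute)

lemma shift_map_inj: "shift_map x = shift_map x' \<Longrightarrow> x = x'"
proof
  fix n assume "shift_map x = shift_map x'"
  then have "shift_map x (n - 1) = shift_map x' (n - 1)" by simp
  then show "x n = x' n" by (simp add: shift_map_def)
qed

text \<open>The corresponding path lies on floor \<open>N\<close> of the level \<open>m\<close>
  tower over \<open>v\<close>. For fixed \<open>m\<close>, these sets form the Kakutani-Rokhlin
  partition carried over to \<open>X\<close>.\<close>

definition located :: "(int \<Rightarrow> 'a) \<Rightarrow> nat \<Rightarrow> nat \<Rightarrow> 'v \<Rightarrow> bool" where
  "located x m N v \<longleftrightarrow> x \<in> X \<and> address (h x) m = N \<and> src B (h x m) = v"

lemma located_in: "located x m N v \<Longrightarrow> x \<in> X"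
  by (simp add: located_def)

lemma located_ex:
  assumes "v \<in> V m" "N < height 0 m"
  shows "\<exists>x. located x m N v"
proof -
  obtain \<gamma> where \<gamma>: "\<gamma> \<in> tail_paths m" "src B (\<gamma> m) = v" using tail_from_vertex[OF assms(1)] by blast
  obtain \<delta> where \<delta>: "\<delta> \<in> paths B" "\<forall>i\<ge>m. \<delta> i = \<gamma> i" "address \<delta> m = N"
    using tail_extend[OF \<gamma>(1) assms(2)] by blast
  obtain x where "x \<in> X" "h x = \<delta>" using h_bij \<delta>(1) by (metis bij_betw_imp_surj_on imageE)
  then show ?thesis using \<gamma> \<delta> by (auto simp: located_def)
qed

lemma located_descend:
  assumes "located x m (N1 + height 0 n * N2) v" "n \<le> m" "N1 < height 0 n"
  shows "located x n N1 (descend n m N2 v)"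
  using assms path_descend[OF h_in assms(2) _ assms(3), of x N2] by (auto simp: located_def)

lemma located_unique_edges:
  assumes "located x m N v" "located x' m N v" "i < m"
  shows "h x i = h x' i"
  using assms address_unique[of "h x" "h x'" m i] h_in by (simp add: located_def)

lemma located_shift:
  assumes "located x m N v" "Suc N < height 0 m"
  shows "located (shift_map x) m (Suc N) v"
  using assms vershik_step[OF h_in, of x m] equivariant shift_map_in by (auto simp: located_def)

text \<open>A point one floor lower in the same tower is constructed and climbs to \<open>x\<close>;
  injectivity of the shift map identifies it with \<open>x'\<close>.\<close>

lemma located_unshift:
  assumes "located x m (Suc N) v" "x = shift_map x'"
  shows "located x' m N v"
proof -
  have x: "x \<in> X" "h x \<in> paths B" "address (h x) m = Suc N" "src B (h x m) = v"
    using assms h_in by (auto simp: located_def)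
  then have less: "Suc N < height 0 m" using address_less by metis
  then obtain \<delta> where \<delta>: "\<delta> \<in> paths B" "\<forall>i\<ge>m. \<delta> i = h x i" "address \<delta> m = N"
    using tail_extend[OF paths_tail[OF x(2)], of N m] by auto
  obtain x'' where x'': "x'' \<in> X" "h x'' = \<delta>" using h_bij \<delta>(1) by (metis bij_betw_imp_surj_on imageE)
  have vd: "vershik B \<delta> \<in> paths B" "\<And>i. i \<ge> m \<Longrightarrow> vershik B \<delta> i = h x i" "address (vershik B \<delta>) m = Suc N"
    using vershik_step[OF \<delta>(1), of m] \<delta> less by auto
  have "vershik B \<delta> i = h x i" for i
    using address_unique[OF vd(1) x(2), of m i] vd x by (cases "i < m") auto
  then have "h (shift_map x'') = h x" using x'' equivariant by auto
  then have "shift_map x'' = shift_map x'" using h_inj[OF shift_map_in[OF x''(1)] x(1)] assms(2) by simp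
  then have "x'' = x'" by (rule shift_map_inj)
  then show ?thesis using x'' \<delta> x by (auto simp: located_def)
qed

lemma located_translate:
  assumes "located x m N v" "N' < height 0 m"
  shows "located (translate (int N' - int N) x) m N' v"
proof (cases "N \<le> N'")
  case True
  then show ?thesis using assms(2)
  proof (induction N' rule: dec_induct)
    case base
    then show ?case using assms(1) by (simp add: translate_def)
  next
    case (step N')
    then show ?case using located_shift[OF step.IH] by (simp add: shift_translate algebra_simps)
  qed
next
  case False
  then have "N' \<le> N" by simp
  then show ?thesis
  proof (induction N' rule: inc_induct)
    case base
    then show ?case using assms(1) by (simp add: translate_def)
  next
    case (step N')
    then show ?case by (rule_tac located_unshift[OF step.IH]) (simp add: shift_translate algebra_simps)
  qed
qed

text \<open>Points on the same floor share their first \<open>m\<close> edges, and at high levels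
  these determine the letter.\<close>

lemma letter_located:
  "\<exists>m0. \<forall>m\<ge>m0. \<forall>N v x x'. located x m N v \<longrightarrow> located x' m N v \<longrightarrow> x 0 = x' 0"
proof -
  obtain m0 where "\<And>x x'. x \<in> X \<Longrightarrow> x' \<in> X \<Longrightarrow> (\<And>i. i < m0 \<Longrightarrow> h x i = h x' i) \<Longrightarrow> x 0 = x' 0"
    using letter_determined by metis
  then show ?thesis
    using located_in located_unique_edges by (intro exI[of _ m0]) (metis less_le_trans)
qed

end

section \<open>Turning the free choices between words into free choices of letters\<close>

locale thick_shift = thick_spine B A z y n0 k + shift_of_diagram B K X h
  for B :: "('v, 'e) bratteli" and A z y n0 k
    and K :: "'a set" and X :: "(int \<Rightarrow> 'a) set" and h
begin

text \<open>A bijective word sends \<open>u\<close> and \<open>u'\<close> to different vertices of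
  level \<open>n0\<close>, so points on the corresponding floors have different edges there, and
  hence different letters within distance \<open>L\<close>. An interior word leaves \<open>L\<close>
  floors of room at both ends, so this letter is read on a floor of the same tower and depends only
  on that floor.\<close>

lemma vertices_separated:
  "\<exists>m1\<ge>n0. \<forall>m\<ge>m1. \<forall>u\<in>A m. \<forall>u'\<in>A m. u \<noteq> u' \<longrightarrow>
    (\<exists>N<height 0 m. \<exists>\<kappa> \<kappa>'. \<kappa> \<noteq> \<kappa>' \<and> (\<forall>x. located x m N u \<longrightarrow> x 0 = \<kappa>) \<and>
      (\<forall>x. located x m N u' \<longrightarrow> x 0 = \<kappa>'))"
proof -
  obtain J where J: "finite J" "\<And>x x'. x \<in> X \<Longrightarrow> x' \<in> X \<Longrightarrow> (\<And>s. s \<in> J \<Longrightarrow> x s = x' s) \<Longrightarrow> h x n0 = h x' n0"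
    using edge_determined[of n0] by metis
  obtain L where L: "\<And>s. s \<in> J \<Longrightarrow> nat \<bar>s\<bar> \<le> L"
    using finite_nat_set_iff_bounded_le[of "(\<lambda>s. nat \<bar>s\<bar>) ` J"] J(1) by auto
  obtain m1 where m1: "m1 \<ge> n0" "\<And>m. m \<ge> m1 \<Longrightarrow>
      \<exists>M. good n0 m M \<and> L \<le> height 0 n0 * M \<and> height 0 n0 * (M + 1) + L \<le> height 0 m"
    using interior_word_ex[of L] by blast
  obtain m2 where m2: "\<And>m N v x x'. m \<ge> m2 \<Longrightarrow> located x m N v \<Longrightarrow> located x' m N v \<Longrightarrow> x 0 = x' 0"
    using letter_located by blast
  have "\<exists>N<height 0 m. \<exists>\<kappa> \<kappa>'. \<kappa> \<noteq> \<kappa>' \<and> (\<forall>x. located x m N u \<longrightarrow> x 0 = \<kappa>) \<and>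
      (\<forall>x. located x m N u' \<longrightarrow> x 0 = \<kappa>')"
    if m: "m \<ge> max m1 m2" and u: "u \<in> A m" "u' \<in> A m" "u \<noteq> u'" for m u u'
  proof -
    obtain M where M: "good n0 m M" "L \<le> height 0 n0 * M" "height 0 n0 * (M + 1) + L \<le> height 0 m"
      using m1(2)[of m] m by auto
    have nm: "n0 \<le> m" using m m1(1) by simp
    let ?N = "height 0 n0 * M"
    have N: "?N + L < height 0 m" using M(3) height_pos[of 0 n0] unfolding distrib_left by linarith
    have "u \<in> V m" "u' \<in> V m" using u A_subset[OF nm] by auto
    then obtain x x' where x: "located x m ?N u" "located x' m ?N u'"
      using located_ex[of _ m ?N] N by (meson add_lessD1)
    have "src B (h x n0) = descend n0 m M u" "src B (h x' n0) = descend n0 m M u'"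
      using located_descend[of x m 0 n0 M u] located_descend[of x' m 0 n0 M u'] x nm height_pos[of 0 n0]
      by (auto simp: located_def)
    moreover have "descend n0 m M u \<noteq> descend n0 m M u'"
      using good_bij[OF order_refl nm M(1)] u by (auto simp: bij_betw_def dest: inj_onD)
    ultimately have "h x n0 \<noteq> h x' n0" by metis
    then obtain s where s: "s \<in> J" "x s \<noteq> x' s" using J(2)[OF located_in located_in] x by blast
    have sL: "\<bar>s\<bar> \<le> int L" using L[OF s(1)] by linarith
    define N' where "N' = nat (int ?N + s)"
    have "int L \<le> int ?N" using M(2) by (simp only: of_nat_le_iff)
    then have N': "int N' - int ?N = s" unfolding N'_def using sL by linarith
    have less: "N' < height 0 m" using N' sL N by linarith
    have "located (translate s x) m N' u" "located (translate s x') m N' u'"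
      using located_translate[OF x(1) less] located_translate[OF x(2) less] unfolding N' by auto
    moreover have "translate s x 0 = x s" "translate s x' 0 = x' s" by (auto simp: translate_def)
    moreover have "m \<ge> m2" using m by simp
    ultimately have "\<forall>x0. located x0 m N' u \<longrightarrow> x0 0 = x s" "\<forall>x0. located x0 m N' u' \<longrightarrow> x0 0 = x' s"
      using m2 by metis+
    then show ?thesis using less s(2) by blast
  qed
  then show ?thesis using m1(1) by (intro exI[of _ "max m1 m2"]) auto
qed

lemma non_tame: "non_tame K X"
proof -
  obtain n1 where n1: "n1 \<ge> n0" "\<And>a0. a0 \<ge> n1 \<Longrightarrow> \<exists>u\<in>A a0. \<exists>u'\<in>A a0. u \<noteq> u' \<and>
    (\<exists>t::nat \<Rightarrow> nat. \<forall>\<phi>::nat \<Rightarrow> bool. \<forall>R. \<exists>b\<ge>a0. \<exists>M<height a0 b. \<exists>v\<in>V b. \<forall>s<R.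
      t s \<le> M \<and> descend a0 b (M - t s) v = (if \<phi> s then u' else u))"
    using independent_descents by blast
  obtain m1 where m1: "m1 \<ge> n0" "\<And>m u u'. m \<ge> m1 \<Longrightarrow> u \<in> A m \<Longrightarrow> u' \<in> A m \<Longrightarrow> u \<noteq> u' \<Longrightarrow>
    (\<exists>N<height 0 m. \<exists>\<kappa> \<kappa>'. \<kappa> \<noteq> \<kappa>' \<and> (\<forall>x. located x m N u \<longrightarrow> x 0 = \<kappa>) \<and>
      (\<forall>x. located x m N u' \<longrightarrow> x 0 = \<kappa>'))"
    using vertices_separated by metis
  define a where "a = max n1 m1"
  have a: "n0 \<le> a" "n1 \<le> a" "m1 \<le> a" using n1 m1 by (auto simp: a_def)
  define P where "P u u' t \<longleftrightarrow> (\<forall>\<phi>::nat \<Rightarrow> bool. \<forall>R. \<exists>b\<ge>a. \<exists>M<height a b. \<exists>v\<in>V b. \<forall>s<R.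
      t s \<le> M \<and> descend a b (M - t s) v = (if \<phi> s then u' else u))" for u u' and t :: "nat \<Rightarrow> nat"
  have "\<exists>u\<in>A a. \<exists>u'\<in>A a. u \<noteq> u' \<and> (\<exists>t. P u u' t)"
    unfolding P_def by (rule n1(2)[OF a(2)])
  then obtain u u' t where u: "u \<in> A a" "u' \<in> A a" "u \<noteq> u'" and t: "P u u' t" by blast
  obtain N \<kappa> \<kappa>' where N: "N < height 0 a" "\<kappa> \<noteq> \<kappa>'"
    "\<And>x. located x a N u \<Longrightarrow> x 0 = \<kappa>" "\<And>x. located x a N u' \<Longrightarrow> x 0 = \<kappa>'"
    using m1(2)[OF a(3) u] by blast
  \<comment> \<open>Subtracting \<open>t s\<close> from the word lowers the floor by
    \<open>height 0 a * t s\<close>, which is a backward translation.\<close>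
  define \<tau> where "\<tau> s = - int (height 0 a * t s)" for s
  have ex: "\<exists>x\<in>X. \<forall>s<R. x (\<tau> s) = (if \<phi> s then \<kappa>' else \<kappa>)" for \<phi> R
  proof -
    obtain b M v where b: "b \<ge> a" "M < height a b" "v \<in> V b" and
      tM: "\<forall>s<R. t s \<le> M \<and> descend a b (M - t s) v = (if \<phi> s then u' else u)"
      using t[unfolded P_def, THEN spec[of _ \<phi>], THEN spec[of _ R]]
      by (elim exE conjE bexE) (rule that)
    have less: "N + height 0 a * M' < height 0 b" if "M' \<le> M" for M'
      using mixed_radix_less[of N 0 a M' b] N(1) b that by simp
    obtain x where x: "located x b (N + height 0 a * M) v" using located_ex[OF b(3) less] by blast
    have "x (\<tau> s) = (if \<phi> s then \<kappa>' else \<kappa>)" if "s < R" for s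
    proof -
      have "t s \<le> M" using tM that by simp
      then obtain d where "M = t s + d" by (auto simp: le_iff_add)
      then have \<tau>: "int (N + height 0 a * (M - t s)) - int (N + height 0 a * M) = \<tau> s"
        by (simp add: \<tau>_def distrib_left)
      have "located (translate (\<tau> s) x) b (N + height 0 a * (M - t s)) v"
        using located_translate[OF x less, of "M - t s"] unfolding \<tau> by simp
      from located_descend[OF this b(1) N(1)]
      have "located (translate (\<tau> s) x) a N (if \<phi> s then u' else u)" using tM that by simp
      then have "translate (\<tau> s) x 0 = (if \<phi> s then \<kappa>' else \<kappa>)" using N(3,4) by (auto split: if_splits)
      then show ?thesis by (simp add: translate_def)
    qed
    then show ?thesis using located_in[OF x] by blast
  qed
  have K: "x i \<in> K" if "x \<in> X" for x i using shift_subset[OF shift] that by (auto simp: PiE_def Pi_def)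
  have "\<kappa> \<in> K" "\<kappa>' \<in> K" using ex[of 1 "\<lambda>_. False"] ex[of 1 "\<lambda>_. True"] K by (metis less_one)+
  \<comment> \<open>Compactness passes from finitely many prescribed letters to all of them at
    once.\<close>
  then have "\<forall>\<phi>. \<exists>x\<in>X. \<forall>s. x (\<tau> s) \<in> (if \<phi> s then {\<kappa>'} else {\<kappa>})"
    using ex by (intro allI shift_coordinates_compactness[OF shift]) (simp_all, metis)
  moreover have "{\<kappa>} \<subseteq> K" "{\<kappa>'} \<subseteq> K" "{\<kappa>} \<inter> {\<kappa>'} = {}"
    using \<open>\<kappa> \<in> K\<close> \<open>\<kappa>' \<in> K\<close> N(2) by auto
  ultimately show ?thesis unfolding non_tame_def by blast
qed

end

theorem theorem1p4:
  fixes K :: "'a set" and X :: "(int \<Rightarrow> 'a) set" and B :: "('v, 'e) bratteli"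
  assumes "toeplitz_shift K X"
    and "toeplitz_BV B"
    and "thick_BV B"
    and "conjugate (shift_topology K X) shift_map (path_topology B) (vershik B)"
  shows "non_tame K X"
proof -
  interpret toeplitz_diagram B by unfold_locales fact
  obtain A z y n0 k where spine: "thick_spine B A z y n0 k"
    using thick_spine_ex[OF assms(3)] by blast
  have shift: "is_shift K X" using assms(1) by (simp add: toeplitz_shift_def)
  obtain h where h: "homeomorphic_map (shift_topology K X) (path_topology B) h"
    "\<And>x. x \<in> X \<Longrightarrow> h (shift_map x) = vershik B (h x)"
    using assms(4) topspace_shift[OF shift] by (auto simp: conjugate_def)
  have "shift_of_diagram B K X h"
    by unfold_locales (use shift h in auto)
  with spine have "thick_shift B A z y n0 k K X h" by (rule thick_shift.intro)
  then show ?thesis by (rule thick_shift.non_tame)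
qed

end
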